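(* Fix $\varepsilon>0$ and $\gamma\in(0,1)$, and let $d_N=(1-\gamma)\sqrt{\frac{\log N}{2\log\log N}}$. Let $G$ be the cyclic group of order $N$, let $d$ be an integer with $2\leqslant d\leqslant d_N$, and let $\Gamma\in\mathcal{G}(G,p)$ with $p\geqslant\sqrt[d]{\frac{d!(1+\varepsilon)}{2^d}\cdot\frac{\log N}{N^{d-1}}}$. Then with high probability the diameter of $\Gamma$ is at most $d$; that is, $\Pr(\operatorname{diam}(\Gamma)>d)\to0$ as $N\to\infty$, uniformly over all such $d$ and $p$.
   Context: For a group $G$ and a subset $S\subseteq G$, the (undirected) Cayley graph $\Gamma(G;S)$ has vertex set $G$ and an edge between $g\neq h$ iff $g^{-1}h\in S$ or $h^{-1}g\in S$ (loops and multiple edges ignored). The model $\mathcal{G}(G,p)$ is the probability space of Cayley graphs $\Gamma(G;S)$ where each element of $G$ is put in $S$ independently with probability $p$. The diameter of a disconnected graph is infinite. *)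

theory Defs
  imports "HOL-Probability.Probability"
begin

text \<open>The cyclic group of order N is modelled as {0..<N} with addition mod N.
  For g, h in the group, g^{-1} h is (h + N - g) mod N.\<close>

definition cyc_inv_mult :: "nat \<Rightarrow> nat \<Rightarrow> nat \<Rightarrow> nat" where
  "cyc_inv_mult N g h = (h + N - g) mod N"

definition cayley_adj :: "nat \<Rightarrow> nat set \<Rightarrow> nat \<Rightarrow> nat \<Rightarrow> bool" where
  "cayley_adj N S g h \<longleftrightarrow> g < N \<and> h < N \<and> g \<noteq> h \<and>
     (cyc_inv_mult N g h \<in> S \<or> cyc_inv_mult N h g \<in> S)"

fun cayley_walk :: "nat \<Rightarrow> nat set \<Rightarrow> nat \<Rightarrow> nat \<Rightarrow> nat \<Rightarrow> bool" where
  "cayley_walk N S 0 g h \<longleftrightarrow> g = h"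
| "cayley_walk N S (Suc k) g h \<longleftrightarrow> (\<exists>x<N. cayley_walk N S k g x \<and> cayley_adj N S x h)"

text \<open>Graph distance (infinite if no walk exists) and diameter (infinite if disconnected).\<close>
definition cayley_dist :: "nat \<Rightarrow> nat set \<Rightarrow> nat \<Rightarrow> nat \<Rightarrow> enat" where
  "cayley_dist N S g h = (INF k \<in> {k. cayley_walk N S k g h}. enat k)"

definition cayley_diam :: "nat \<Rightarrow> nat set \<Rightarrow> enat" where
  "cayley_diam N S = (SUP gh \<in> {0..<N} \<times> {0..<N}. cayley_dist N S (fst gh) (snd gh))"

definition prob_diam_gt :: "nat \<Rightarrow> real \<Rightarrow> nat \<Rightarrow> real" where
  "prob_diam_gt N p d =
     measure_pmf.prob (Pi_pmf {0..<N} False (\<lambda>_. bernoulli_pmf p))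
       {f. cayley_diam N {x. x < N \<and> f x} > enat d}"

end

theory Submission
  imports Defs
begin

text \<open>
  By monotonicity in \<open>p\<close> it suffices to treat the threshold value of \<open>p\<close>. For a residue \<open>g \<noteq> 0\<close>,
  consider the \<open>d\<close>-element sets \<open>A\<close> some signed sum of whose elements is \<open>g\<close>; if one of them is
  contained in \<open>S\<close>, all pairs of vertices with difference \<open>g\<close> are at distance at most \<open>d\<close>. There are
  asymptotically \<open>2^d N^(d-1) / d!\<close> such sets, so the expected number inside \<open>S\<close> is about
  \<open>(1 + \<epsilon>) log N\<close>, and the intersecting pairs contribute a negligible correction because
  \<open>N^(1/d) \<ge> (log N)^(2d)\<close>. Janson's inequality bounds the failure probability of \<open>g\<close> by
  \<open>N^(-1-\<epsilon>/2)\<close>, which survives the union bound over \<open>g\<close>. The element of order two is exceptional: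
  each signing of a set with sum \<open>N/2\<close> comes with its negative, so there are only half as many sets,
  but the resulting bound \<open>N^(-1/2)\<close> is needed just once.
\<close>

subsection \<open>Harris' and Janson's inequalities\<close>

abbreviation random_subset :: "'a set \<Rightarrow> real \<Rightarrow> ('a \<Rightarrow> bool) pmf" where
  "random_subset V p \<equiv> Pi_pmf V False (\<lambda>_. bernoulli_pmf p)"

text \<open>Conditions on the coordinate \<open>x\<close>. Harris' inequality, monotonicity in
  \<open>p\<close> and the conditioning formula below all come from repeating this split.\<close>

lemma prob_random_subset_insert:
  assumes "finite V" "x \<notin> V" "0 \<le> p" "p \<le> 1"
  shows "measure_pmf.prob (random_subset (insert x V) p) {f. Q f} =
    p * measure_pmf.prob (random_subset V p) {f. Q (f(x := True))} +
    (1 - p) * measure_pmf.prob (random_subset V p) {f. Q (f(x := False))}"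
proof -
  let ?M = "random_subset V p"
  have "random_subset (insert x V) p =
      bernoulli_pmf p \<bind> (\<lambda>y. map_pmf (\<lambda>f. f(x := y)) ?M)"
    using assms by (simp add: Pi_pmf_insert' map_pmf_def)
  then have "emeasure (random_subset (insert x V) p) {f. Q f} =
      (\<integral>\<^sup>+y. emeasure ?M {f. Q (f(x := y))} \<partial>bernoulli_pmf p)"
    by (simp add: vimage_def)
  also have "\<dots> = ennreal (p * measure_pmf.prob ?M {f. Q (f(x := True))} +
    (1 - p) * measure_pmf.prob ?M {f. Q (f(x := False))})"
    using assms by (simp add: measure_pmf.emeasure_eq_measure ennreal_mult ennreal_plus mult.commute)
  finally show ?thesis
    unfolding measure_def using assms by (simp del: ennreal_plus)
qed

text \<open>Induction on the number of coordinates. Given the value of one coordinate, the induction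
  hypothesis decorrelates the rest; the two conditional probabilities then move in opposite
  directions with that coordinate, which is the two-point case of Chebyshev's sum
  inequality.\<close>

lemma Harris_inequality:
  assumes "finite V" "0 \<le> p" "p \<le> 1"
    and "\<And>f g. f \<le> g \<Longrightarrow> X f \<Longrightarrow> X g" and "\<And>f g. f \<le> g \<Longrightarrow> Y g \<Longrightarrow> Y f"
  shows "measure_pmf.prob (random_subset V p) {f. X f \<and> Y f} \<le>
    measure_pmf.prob (random_subset V p) {f. X f} * measure_pmf.prob (random_subset V p) {f. Y f}"
  using assms(1,4,5)
proof (induction V arbitrary: X Y rule: finite_induct)
  case empty
  show ?case by (auto simp: indicator_def)
next
  case (insert x V)
  let ?P = "\<lambda>Q. measure_pmf.prob (random_subset V p) {f. Q f}"
  have upd: "f(x := b) \<le> g(x := b)" if "f \<le> g" for f g :: "'a \<Rightarrow> bool" and b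
    using that by (auto simp: le_fun_def)
  define x1 x0 y1 y0 where "x1 = ?P (\<lambda>f. X (f(x := True)))" and "x0 = ?P (\<lambda>f. X (f(x := False)))"
    and "y1 = ?P (\<lambda>f. Y (f(x := True)))" and "y0 = ?P (\<lambda>f. Y (f(x := False)))"
  have up: "f(x := False) \<le> f(x := True)" for f :: "'a \<Rightarrow> bool"
    by (auto simp: le_fun_def)
  have "x0 \<le> x1" unfolding x0_def x1_def
    by (rule measure_pmf.finite_measure_mono) (auto intro: insert.prems(1)[OF up])
  moreover have "y1 \<le> y0" unfolding y0_def y1_def
    by (rule measure_pmf.finite_measure_mono) (auto intro: insert.prems(2)[OF up])
  \<comment> \<open>This is exactly the gap between the product of the two averages and the average
    of the products.\<close>
  ultimately have cross: "0 \<le> p * (1 - p) * ((x1 - x0) * (y0 - y1))"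
    using assms by (intro mult_nonneg_nonneg) auto
  have IH: "?P (\<lambda>f. X (f(x := b)) \<and> Y (f(x := b))) \<le> ?P (\<lambda>f. X (f(x := b))) * ?P (\<lambda>f. Y (f(x := b)))" for b
    by (rule insert.IH) (use upd insert.prems in blast)+
  have "measure_pmf.prob (random_subset (insert x V) p) {f. X f \<and> Y f} =
      p * ?P (\<lambda>f. X (f(x := True)) \<and> Y (f(x := True))) +
      (1 - p) * ?P (\<lambda>f. X (f(x := False)) \<and> Y (f(x := False)))"
    using insert assms by (subst prob_random_subset_insert) auto
  also have "\<dots> \<le> p * (x1 * y1) + (1 - p) * (x0 * y0)"
    unfolding x1_def x0_def y1_def y0_def using assms
    by (intro add_mono mult_left_mono IH) auto
  also have "\<dots> \<le> (p * x1 + (1 - p) * x0) * (p * y1 + (1 - p) * y0)"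
    using cross by (simp add: algebra_simps power2_eq_square)
  also have "\<dots> = measure_pmf.prob (random_subset (insert x V) p) {f. X f} *
      measure_pmf.prob (random_subset (insert x V) p) {f. Y f}"
    using insert assms unfolding x1_def x0_def y1_def y0_def
    by (simp add: prob_random_subset_insert)
  finally show ?case .
qed

text \<open>Takes the place of a coupling argument: lowering \<open>q\<close> to \<open>p\<close> in
  one coordinate moves weight \<open>q - p\<close> from the branch \<open>True\<close> to the branch
  \<open>False\<close>, where a decreasing event is at least as likely.\<close>

lemma prob_decreasing_antimono:
  assumes "finite V" "0 \<le> p" "p \<le> q" "q \<le> 1"
    and "\<And>f g. f \<le> g \<Longrightarrow> Y g \<Longrightarrow> Y f"
  shows "measure_pmf.prob (random_subset V q) {f. Y f} \<le> measure_pmf.prob (random_subset V p) {f. Y f}"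
  using assms(1,5)
proof (induction V arbitrary: Y rule: finite_induct)
  case empty
  show ?case by simp
next
  case (insert x V)
  let ?P = "\<lambda>p Q. measure_pmf.prob (random_subset V p) {f. Q f}"
  have IH: "?P q (\<lambda>f. Y (f(x := b))) \<le> ?P p (\<lambda>f. Y (f(x := b)))" for b
  proof (rule insert.IH)
    fix f g :: "'a \<Rightarrow> bool" assume "f \<le> g" "Y (g(x := b))"
    moreover have "f(x := b) \<le> g(x := b)" using \<open>f \<le> g\<close> by (auto simp: le_fun_def)
    ultimately show "Y (f(x := b))" using insert.prems by blast
  qed
  have "?P p (\<lambda>f. Y (f(x := True))) \<le> ?P p (\<lambda>f. Y (f(x := False)))"
  proof (rule measure_pmf.finite_measure_mono)
    have "f(x := False) \<le> f(x := True)" for f :: "'a \<Rightarrow> bool"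
      by (auto simp: le_fun_def)
    then show "{f. Y (f(x := True))} \<subseteq> {f. Y (f(x := False))}"
      using insert.prems by blast
  qed simp
  then have "(q - p) * ?P p (\<lambda>f. Y (f(x := True))) \<le> (q - p) * ?P p (\<lambda>f. Y (f(x := False)))"
    using assms by (intro mult_left_mono) auto
  moreover have "q * ?P q (\<lambda>f. Y (f(x := True))) + (1 - q) * ?P q (\<lambda>f. Y (f(x := False))) \<le>
      q * ?P p (\<lambda>f. Y (f(x := True))) + (1 - q) * ?P p (\<lambda>f. Y (f(x := False)))"
    using assms by (intro add_mono mult_left_mono IH) auto
  ultimately show ?case
    using insert assms by (simp add: prob_random_subset_insert algebra_simps)
qed

text \<open>Conditioning on \<open>A\<close> without conditional probabilities: the coordinates
  outside \<open>A\<close> keep their law, so \<open>Q\<close> is evaluated with the elements of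
  \<open>A\<close> forced in, one at a time.\<close>

lemma prob_random_subset_superset:
  assumes "finite V" "A \<subseteq> V" "0 \<le> p" "p \<le> 1"
  shows "measure_pmf.prob (random_subset V p) {f. (\<forall>x\<in>A. f x) \<and> Q f} =
    p ^ card A * measure_pmf.prob (random_subset V p) {f. Q (\<lambda>x. x \<in> A \<or> f x)}"
proof -
  have "finite A" using assms finite_subset by blast
  then show ?thesis using assms(2)
  proof (induction A arbitrary: Q rule: finite_induct)
    case empty
    show ?case by simp
  next
    case (insert x A)
    obtain U where V: "V = insert x U" and U: "finite U" "x \<notin> U"
      using insert.prems assms(1) by (metis finite_insert insert_subset mk_disjoint_insert)
    have single: "measure_pmf.prob (random_subset V p) {f. f x \<and> R f} =
      p * measure_pmf.prob (random_subset V p) {f. R (f(x := True))}" for R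
      unfolding V using U assms(3,4) by (simp add: prob_random_subset_insert algebra_simps)
    have "measure_pmf.prob (random_subset V p) {f. (\<forall>y\<in>insert x A. f y) \<and> Q f} =
      measure_pmf.prob (random_subset V p) {f. (\<forall>y\<in>A. f y) \<and> (f x \<and> Q f)}"
      by (intro arg_cong2[where f = measure]) auto
    also have "\<dots> = p ^ card A * measure_pmf.prob (random_subset V p)
        {f. (x \<in> A \<or> f x) \<and> Q (\<lambda>y. y \<in> A \<or> f y)}"
      using insert.prems insert.IH[of "\<lambda>f. f x \<and> Q f"] by auto
    also have "\<dots> = p ^ card A * measure_pmf.prob (random_subset V p)
        {f. f x \<and> Q (\<lambda>y. y \<in> A \<or> f y)}"
      using insert by simp
    also have "\<dots> = p ^ card A * (p * measure_pmf.prob (random_subset V p)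
        {f. Q (\<lambda>y. y \<in> A \<or> (f(x := True)) y)})"
      using single[of "\<lambda>f. Q (\<lambda>y. y \<in> A \<or> f y)"] by simp
    also have "{f. Q (\<lambda>y. y \<in> A \<or> (f(x := True)) y)} = {f. Q (\<lambda>y. y \<in> insert x A \<or> f y)}"
    proof -
      have "(\<lambda>y. y \<in> A \<or> (f(x := True)) y) = (\<lambda>y. y \<in> insert x A \<or> f y)" for f
        by (auto simp: fun_eq_iff)
      then show ?thesis by (simp only:)
    qed
    finally show ?case using insert by simp
  qed
qed

text \<open>The Boppana--Spencer step. Conditioning on \<open>A\<close> being contained in the random set leaves the
  members of \<open>E\<close> disjoint from \<open>A\<close> unaffected, and Harris' inequality bounds the
  contribution of each member meeting \<open>A\<close>.\<close>
lemma Janson_step: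
  fixes V :: "'a set"
  assumes V: "finite V" "0 \<le> p" "p \<le> 1" and E: "finite E" "E \<subseteq> Pow V" "A \<subseteq> V"
  defines "P \<equiv> \<lambda>Q. measure_pmf.prob (random_subset V p) {f. Q f}"
  defines "W \<equiv> \<lambda>E f. \<forall>B\<in>E. \<exists>x\<in>B. \<not> f x"
  shows "P (W (insert A E)) \<le> P (W E) *
    exp (- (p ^ card A * (1 - (\<Sum>B\<in>{B\<in>E. B \<inter> A \<noteq> {}}. p ^ card (B - A)))))"
proof -
  define D where "D = {B\<in>E. B \<inter> A \<noteq> {}}"
  define s where "s = (\<Sum>B\<in>D. p ^ card (B - A))"
  have finD: "finite D" using E D_def by auto
  have P0: "0 \<le> P Q" for Q unfolding P_def by simp
  have Pmono: "P Q \<le> P R" if "\<And>f. Q f \<Longrightarrow> R f" for Q R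
    unfolding P_def using that by (intro measure_pmf.finite_measure_mono) auto
  \<comment> \<open>\<open>?S f\<close> is the random set with \<open>A\<close> added, that is, the
    random set conditioned on containing \<open>A\<close>.\<close>
  let ?S = "\<lambda>f x. x \<in> A \<or> f x"
  have single: "P (\<lambda>f. W (E - D) f \<and> (\<forall>x\<in>B. ?S f x)) \<le> p ^ card (B - A) * P (W (E - D))" if "B \<in> D" for B
  proof -
    have B: "B \<subseteq> V" using that E D_def by auto
    have "P (\<lambda>f. W (E - D) f \<and> (\<forall>x\<in>B. ?S f x)) = P (\<lambda>f. (\<forall>x\<in>B - A. f x) \<and> W (E - D) f)"
      unfolding P_def by (intro arg_cong2[where f = measure]) auto
    also have "\<dots> \<le> P (\<lambda>f. \<forall>x\<in>B - A. f x) * P (W (E - D))"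
      unfolding P_def
    proof (rule Harris_inequality[OF V])
      show "\<forall>x\<in>B - A. g x" if "f \<le> g" "\<forall>x\<in>B - A. f x" for f g
        using that by (auto simp: le_fun_def)
      show "W (E - D) f" if "f \<le> g" "W (E - D) g" for f g
        using that unfolding W_def le_fun_def le_bool_def by blast
    qed
    also have "P (\<lambda>f. \<forall>x\<in>B - A. f x) = p ^ card (B - A)"
      using prob_random_subset_superset[of V "B - A" p "\<lambda>_. True"] V B unfolding P_def by auto
    finally show ?thesis .
  qed
  \<comment> \<open>Adding \<open>A\<close> cannot complete a set disjoint from \<open>A\<close>. So
    if \<open>W (E - D)\<close> holds, then either \<open>W E\<close> survives the addition or some
    member of \<open>D\<close> is completed by it; the second event is handled by a union bound and
    \<open>single\<close>.\<close>
  have "P (W (E - D)) \<le> P (\<lambda>f. W E (?S f)) + P (\<lambda>f. \<exists>B\<in>D. W (E - D) f \<and> (\<forall>x\<in>B. ?S f x))"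
  proof -
    have dis: "W (E - D) (?S f)" if Wf: "W (E - D) f" for f
      unfolding W_def
    proof
      fix B assume "B \<in> E - D"
      then obtain x where "x \<in> B" "\<not> f x" "B \<inter> A = {}"
        using Wf unfolding W_def D_def by blast
      then show "\<exists>x\<in>B. \<not> ?S f x" by blast
    qed
    have "W E (?S f)" if "W (E - D) f" "\<not> (\<exists>B\<in>D. \<forall>x\<in>B. ?S f x)" for f
      using dis[OF that(1)] that(2) unfolding W_def by (metis DiffI)
    then have "{f. W (E - D) f} \<subseteq> {f. W E (?S f)} \<union> {f. \<exists>B\<in>D. W (E - D) f \<and> (\<forall>x\<in>B. ?S f x)}"
      by blast
    then show ?thesis unfolding P_def
      by (intro order_trans[OF measure_pmf.finite_measure_mono measure_Un_le]) auto
  qed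
  also have "P (\<lambda>f. \<exists>B\<in>D. W (E - D) f \<and> (\<forall>x\<in>B. ?S f x)) \<le>
      (\<Sum>B\<in>D. P (\<lambda>f. W (E - D) f \<and> (\<forall>x\<in>B. ?S f x)))"
  proof -
    have "{f. \<exists>B\<in>D. W (E - D) f \<and> (\<forall>x\<in>B. ?S f x)} = (\<Union>B\<in>D. {f. W (E - D) f \<and> (\<forall>x\<in>B. ?S f x)})"
      by auto
    then show ?thesis unfolding P_def
      by (simp only:) (rule measure_pmf.finite_measure_subadditive_finite, use finD in auto)
  qed
  also have "\<dots> \<le> s * P (W (E - D))"
    unfolding s_def sum_distrib_right by (rule sum_mono) (rule single)
  finally have low: "(1 - s) * P (W (E - D)) \<le> P (\<lambda>f. W E (?S f))"
    by (simp add: algebra_simps)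
  \<comment> \<open>Passing from \<open>E - D\<close> to the smaller event for \<open>E\<close>
    preserves the bound when \<open>1 - s\<close> is nonnegative; otherwise the left side is at most
    zero.\<close>
  have "(1 - s) * P (W E) \<le> P (\<lambda>f. W E (?S f))"
  proof (cases "s \<le> 1")
    case True
    have "P (W E) \<le> P (W (E - D))" by (rule Pmono) (auto simp: W_def)
    then have "(1 - s) * P (W E) \<le> (1 - s) * P (W (E - D))"
      using True by (intro mult_left_mono) auto
    then show ?thesis using low by linarith
  next
    case False
    then have "(1 - s) * P (W E) \<le> 0" using P0 by (simp add: mult_nonpos_nonneg)
    then show ?thesis using P0 order_trans by blast
  qed
  then have "p ^ card A * ((1 - s) * P (W E)) \<le> p ^ card A * P (\<lambda>f. W E (?S f))"
    using V by (intro mult_left_mono) auto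
  also have "\<dots> = P (\<lambda>f. (\<forall>x\<in>A. f x) \<and> W E f)"
    unfolding P_def using prob_random_subset_superset[of V A p "W E"] V E by simp
  finally have both: "p ^ card A * ((1 - s) * P (W E)) \<le> P (\<lambda>f. (\<forall>x\<in>A. f x) \<and> W E f)" .
  \<comment> \<open>Splits \<open>W E\<close> according to whether \<open>A\<close> lies in the
    random set; the second part is precisely \<open>W (insert A E)\<close>.\<close>
  have "P (W E) = P (\<lambda>f. (\<forall>x\<in>A. f x) \<and> W E f) + P (W (insert A E))"
    unfolding P_def
    by (subst measure_pmf.finite_measure_Union[symmetric])
       (auto simp: W_def intro!: arg_cong2[where f = measure])
  then have "P (W (insert A E)) \<le> P (W E) * (1 + - (p ^ card A * (1 - s)))"
    using both by (simp add: algebra_simps)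
  also have "\<dots> \<le> P (W E) * exp (- (p ^ card A * (1 - s)))"
    by (intro mult_left_mono P0 exp_ge_add_one_self)
  finally show ?thesis unfolding s_def D_def .
qed

text \<open>The sets are added one at a time, each contributing one factor from
  \<open>Janson_step\<close>. Instead of the usual sum over dependent pairs, \<open>\<eta>\<close>
  bounds, uniformly in \<open>A\<close>, the expected number of other sets meeting \<open>A\<close>
  that are present once \<open>A\<close> is.\<close>

lemma Janson_inequality:
  fixes V :: "'a set"
  assumes V: "finite V" "0 \<le> p" "p \<le> 1" and F: "F \<subseteq> Pow V"
    and dep: "\<And>A. A \<in> F \<Longrightarrow> (\<Sum>B\<in>{B\<in>F. B \<noteq> A \<and> B \<inter> A \<noteq> {}}. p ^ card (B - A)) \<le> \<eta>"
  shows "measure_pmf.prob (random_subset V p) {f. \<forall>A\<in>F. \<exists>x\<in>A. \<not> f x} \<le>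
    exp (- ((1 - \<eta>) * (\<Sum>A\<in>F. p ^ card A)))"
proof -
  have finF: "finite F" using F V by (meson finite_Pow_iff finite_subset)
  have "measure_pmf.prob (random_subset V p) {f. \<forall>A\<in>E. \<exists>x\<in>A. \<not> f x} \<le>
    exp (- ((1 - \<eta>) * (\<Sum>A\<in>E. p ^ card A)))" if "finite E" "E \<subseteq> F" for E
    using that
  proof (induction E rule: finite_induct)
    case empty
    show ?case by simp
  next
    case (insert A E)
    have "(\<Sum>B\<in>{B\<in>E. B \<inter> A \<noteq> {}}. p ^ card (B - A)) \<le>
        (\<Sum>B\<in>{B\<in>F. B \<noteq> A \<and> B \<inter> A \<noteq> {}}. p ^ card (B - A))"
      using insert finF V by (intro sum_mono2) auto
    then have s: "(\<Sum>B\<in>{B\<in>E. B \<inter> A \<noteq> {}}. p ^ card (B - A)) \<le> \<eta>"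
      using dep[of A] insert.prems by auto
    have "measure_pmf.prob (random_subset V p) {f. \<forall>B\<in>insert A E. \<exists>x\<in>B. \<not> f x} \<le>
       measure_pmf.prob (random_subset V p) {f. \<forall>B\<in>E. \<exists>x\<in>B. \<not> f x} *
       exp (- (p ^ card A * (1 - (\<Sum>B\<in>{B\<in>E. B \<inter> A \<noteq> {}}. p ^ card (B - A)))))"
      by (rule Janson_step) (use V F insert in auto)
    also have "\<dots> \<le> exp (- ((1 - \<eta>) * (\<Sum>B\<in>E. p ^ card B))) * exp (- (p ^ card A * (1 - \<eta>)))"
      using insert s V by (intro mult_mono) (auto intro!: mult_left_mono)
    also have "\<dots> = exp (- ((1 - \<eta>) * (\<Sum>B\<in>insert A E. p ^ card B)))"
      using insert by (simp add: exp_add[symmetric] algebra_simps)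
    finally show ?case .
  qed
  then show ?thesis using finF by blast
qed

subsection \<open>Counting signed representations\<close>

definition signs :: "nat \<Rightarrow> (nat \<Rightarrow> int) set" where
  "signs d = {..<d} \<rightarrow>\<^sub>E {- 1, 1}"

text \<open>Ordered tuples, coded as extensional functions, in which values may repeat. The equation
  in the cyclic group is written as a divisibility over \<open>int\<close>, so that equations can be
  subtracted.\<close>

definition signed_sols :: "nat \<Rightarrow> nat \<Rightarrow> nat \<Rightarrow> (nat \<Rightarrow> int) \<Rightarrow> (nat \<Rightarrow> nat) set" where
  "signed_sols N g d \<sigma> =
    {a \<in> {..<d} \<rightarrow>\<^sub>E {..<N}. int N dvd (\<Sum>i<d. \<sigma> i * int (a i)) - int g}"

definition neg_signs :: "nat \<Rightarrow> (nat \<Rightarrow> int) \<Rightarrow> nat \<Rightarrow> int" where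
  "neg_signs d \<sigma> = restrict (\<lambda>i. - \<sigma> i) {..<d}"

text \<open>Injectivity gives every set exactly \<open>d\<close> elements, so each lies in the
  random set with the same probability \<open>p ^ d\<close>.\<close>

definition rep_sets :: "nat \<Rightarrow> nat \<Rightarrow> nat \<Rightarrow> nat set set" where
  "rep_sets N g d = (\<Union>\<sigma>\<in>signs d. (\<lambda>a. a ` {..<d}) ` {a \<in> signed_sols N g d \<sigma>. inj_on a {..<d}})"

lemma finite_signs: "finite (signs d)" and card_signs: "card (signs d) = 2 ^ d"
  unfolding signs_def by (simp_all add: card_PiE finite_PiE numeral_2_eq_2)

lemma finite_signed_sols: "finite (signed_sols N g d \<sigma>)"
  unfolding signed_sols_def by (rule finite_subset[of _ "{..<d} \<rightarrow>\<^sub>E {..<N}"]) (auto intro!: finite_PiE)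

lemma signs_cases: "\<sigma> \<in> signs d \<Longrightarrow> i < d \<Longrightarrow> \<sigma> i = 1 \<or> \<sigma> i = - 1"
  unfolding signs_def by (auto simp: PiE_iff)

lemma signs_eqI:
  assumes "\<sigma> \<in> signs d" "\<tau> \<in> signs d" "\<And>i. i < d \<Longrightarrow> \<sigma> i = \<tau> i"
  shows "\<sigma> = \<tau>"
  using assms unfolding signs_def by (intro PiE_ext[of \<sigma> "{..<d}"]) auto

lemma neg_signs_in_signs: "\<sigma> \<in> signs d \<Longrightarrow> neg_signs d \<sigma> \<in> signs d"
  unfolding signs_def neg_signs_def by (auto simp: PiE_iff)

lemma dvd_sign_mult_iff:
  assumes "\<sigma> \<in> signs d" "i < d"
  shows "n dvd \<sigma> i * x \<longleftrightarrow> n dvd x"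
  using signs_cases[OF assms] by auto

lemma eq_if_dvd_diff:
  assumes "int N dvd int x - int y" "x < N" "y < N"
  shows "x = y"
proof -
  have "int x mod int N = int y mod int N" using assms(1) by (simp only: mod_eq_dvd_iff)
  then show ?thesis using assms(2,3) by simp
qed

text \<open>Doubling modulo \<open>N\<close> identifies only residues that differ by
  \<open>N / 2\<close>, and two numbers in the same half of the range are closer than that.\<close>

lemma eq_if_dvd_double_diff:
  assumes "int N dvd 2 * (int x - int y)" "x < N" "y < N" "2 * x < N \<longleftrightarrow> 2 * y < N"
  shows "x = y"
proof -
  obtain c where c: "2 * (int x - int y) = int N * c" using assms(1) by (auto elim: dvdE)
  have "\<bar>2 * (int x - int y)\<bar> < int N" using assms by auto
  then have "int N * \<bar>c\<bar> < int N * 1" using c by (simp add: abs_mult)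
  then have "\<bar>c\<bar> < 1" by (rule mult_left_less_imp_less) simp
  then have "c = 0" by simp
  then show ?thesis using c by simp
qed

lemma signed_sum_diff:
  fixes a b :: "nat \<Rightarrow> nat" and \<sigma> :: "nat \<Rightarrow> int"
  assumes "K \<subseteq> {..<d}" "\<And>i. i < d \<Longrightarrow> i \<notin> K \<Longrightarrow> a i = b i"
  shows "(\<Sum>i<d. \<sigma> i * int (a i)) - (\<Sum>i<d. \<sigma> i * int (b i)) = (\<Sum>i\<in>K. \<sigma> i * (int (a i) - int (b i)))"
proof -
  have "(\<Sum>i<d. \<sigma> i * int (a i)) - (\<Sum>i<d. \<sigma> i * int (b i)) = (\<Sum>i<d. \<sigma> i * (int (a i) - int (b i)))"
    by (simp add: sum_subtractf algebra_simps)
  also have "\<dots> = (\<Sum>i\<in>K. \<sigma> i * (int (a i) - int (b i)))"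
    using assms by (intro sum.mono_neutral_right) auto
  finally show ?thesis .
qed

lemma signed_sols_dvd_diff:
  assumes "a \<in> signed_sols N g d \<sigma>" "b \<in> signed_sols N g d \<sigma>"
    and "K \<subseteq> {..<d}" "\<And>i. i < d \<Longrightarrow> i \<notin> K \<Longrightarrow> a i = b i"
  shows "int N dvd (\<Sum>i\<in>K. \<sigma> i * (int (a i) - int (b i)))"
proof -
  have "int N dvd ((\<Sum>i<d. \<sigma> i * int (a i)) - int g) - ((\<Sum>i<d. \<sigma> i * int (b i)) - int g)"
    using assms(1,2) unfolding signed_sols_def by (simp only: mem_Collect_eq dvd_diff)
  then show ?thesis using signed_sum_diff[OF assms(3,4), where \<sigma> = \<sigma>] by simp
qed

lemma signed_sols_ext:
  assumes "a \<in> signed_sols N g d \<sigma>" "b \<in> signed_sols N g d \<sigma>" "\<And>i. i < d \<Longrightarrow> a i = b i"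
  shows "a = b"
  using assms unfolding signed_sols_def by (intro PiE_ext[of a "{..<d}"]) auto

lemma signed_sols_less: "a \<in> signed_sols N g d \<sigma> \<Longrightarrow> i < d \<Longrightarrow> a i < N"
  unfolding signed_sols_def by (auto simp: PiE_iff)

text \<open>The coefficient of coordinate \<open>k\<close> is a unit modulo \<open>N\<close>, so the
  equation can be solved for it. Each use of this fact saves one factor of \<open>N\<close> in the
  counts.\<close>

lemma signed_sols_determined:
  assumes \<sigma>: "\<sigma> \<in> signs d" and k: "k < d"
    and ab: "a \<in> signed_sols N g d \<sigma>" "b \<in> signed_sols N g d \<sigma>"
    and agree: "\<And>i. i < d \<Longrightarrow> i \<noteq> k \<Longrightarrow> a i = b i"
  shows "a = b"
proof (rule signed_sols_ext[OF ab])
  have "int N dvd \<sigma> k * (int (a k) - int (b k))"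
    using signed_sols_dvd_diff[OF ab, of "{k}"] k agree by simp
  then have "int N dvd int (a k) - int (b k)" using dvd_sign_mult_iff[OF \<sigma> k] by blast
  then have "a k = b k" by (rule eq_if_dvd_diff) (use signed_sols_less ab k in auto)
  then show "a i = b i" if "i < d" for i using agree that by blast
qed

lemma card_signed_sols_ge:
  assumes \<sigma>: "\<sigma> \<in> signs d" and d: "0 < d" and N: "0 < N"
  shows "N ^ (d - 1) \<le> card (signed_sols N g d \<sigma>)"
proof -
  define k where "k = d - 1"
  have k: "k < d" and dk: "{..<d} = insert k {..<k}" using d by (auto simp: k_def)
  let ?D = "{..<k} \<rightarrow>\<^sub>E {..<N}"
  \<comment> \<open>Solves the equation for the last coordinate; the sign \<open>\<sigma> k\<close>
    is its own inverse.\<close>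
  define c where "c b = nat ((\<sigma> k * (int g - (\<Sum>i<k. \<sigma> i * int (b i)))) mod int N)" for b :: "nat \<Rightarrow> nat"
  have "b(k := c b) \<in> signed_sols N g d \<sigma>" if "b \<in> ?D" for b
  proof -
    have ck: "int (c b) = (\<sigma> k * (int g - (\<Sum>i<k. \<sigma> i * int (b i)))) mod int N"
      unfolding c_def using N by simp
    then have "int (c b) < int N" using N by simp
    then have "c b < N" by simp
    have sq: "\<sigma> k * \<sigma> k = 1" using signs_cases[OF \<sigma> k] by auto
    have "(\<Sum>i<d. \<sigma> i * int ((b(k := c b)) i)) = \<sigma> k * int (c b) + (\<Sum>i<k. \<sigma> i * int (b i))"
      unfolding dk by (simp add: sum.insert)
    then have eq: "(\<Sum>i<d. \<sigma> i * int ((b(k := c b)) i)) - int g =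
        \<sigma> k * (int (c b) - \<sigma> k * (int g - (\<Sum>i<k. \<sigma> i * int (b i))))"
      by (simp add: right_diff_distrib mult.assoc[symmetric] sq)
    have "int N dvd int (c b) - \<sigma> k * (int g - (\<Sum>i<k. \<sigma> i * int (b i)))"
      unfolding ck by (simp add: mod_eq_dvd_iff[symmetric])
    then have "int N dvd (\<Sum>i<d. \<sigma> i * int ((b(k := c b)) i)) - int g"
      unfolding eq by simp
    moreover have "b(k := c b) \<in> {..<d} \<rightarrow>\<^sub>E {..<N}"
      unfolding dk using \<open>c b < N\<close> that by (intro PiE_fun_upd) auto
    ultimately show ?thesis unfolding signed_sols_def by blast
  qed
  moreover have "inj_on (\<lambda>b. b(k := c b)) ?D"
  proof
    fix a b assume ab: "a \<in> ?D" "b \<in> ?D" "a(k := c a) = b(k := c b)"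
    show "a = b"
    proof (rule PiE_ext[OF ab(1,2)])
      show "a i = b i" if "i \<in> {..<k}" for i
        using fun_cong[OF ab(3), of i] that by simp
    qed
  qed
  ultimately have "card ?D \<le> card (signed_sols N g d \<sigma>)"
    by (intro card_inj_on_le[OF _ _ finite_signed_sols]) auto
  then show ?thesis by (simp add: card_PiE k_def)
qed

text \<open>Off the positions \<open>i\<close> and \<open>k\<close> the values are free. The divisibility assumption determines
  \<open>a i\<close> up to a shift by \<open>N / 2\<close>, so the bit \<open>2 * a i < N\<close> pins it down, and the equation then
  determines \<open>a k\<close>.\<close>
lemma card_signed_sols_subset_le:
  assumes \<sigma>: "\<sigma> \<in> signs d" and ik: "i < d" "k < d" "i \<noteq> k" and X: "X \<subseteq> signed_sols N g d \<sigma>"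
    and dbl: "\<And>a b. a \<in> X \<Longrightarrow> b \<in> X \<Longrightarrow> (\<And>l. l < d \<Longrightarrow> l \<noteq> i \<Longrightarrow> l \<noteq> k \<Longrightarrow> a l = b l) \<Longrightarrow>
      int N dvd 2 * (int (a i) - int (b i))"
  shows "card X \<le> 2 * N ^ (d - 2)"
proof -
  let ?J = "{..<d} - {i, k}"
  let ?h = "\<lambda>a. (restrict a ?J, 2 * a i < N)"
  have "inj_on ?h X"
  proof
    fix a b assume ab: "a \<in> X" "b \<in> X" "?h a = ?h b"
    have agree: "a l = b l" if "l < d" "l \<noteq> i" "l \<noteq> k" for l
    proof -
      have "restrict a ?J l = restrict b ?J l" using ab(3) by simp
      then show ?thesis using that by simp
    qed
    have "int N dvd 2 * (int (a i) - int (b i))" by (rule dbl[OF ab(1,2) agree])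
    then have "a i = b i"
      by (rule eq_if_dvd_double_diff) (use ab X signed_sols_less ik(1) in auto)
    then show "a = b"
      using signed_sols_determined[OF \<sigma> ik(2), of a N g b] agree ab X by blast
  qed
  moreover have "?h ` X \<subseteq> (?J \<rightarrow>\<^sub>E {..<N}) \<times> UNIV"
  proof -
    have "restrict a ?J \<in> ?J \<rightarrow>\<^sub>E {..<N}" if "a \<in> X" for a
      using that X signed_sols_less[of a N g d \<sigma>] by (intro restrict_PiE_iff[THEN iffD2]) auto
    then show ?thesis by blast
  qed
  moreover have "finite ((?J \<rightarrow>\<^sub>E {..<N}) \<times> (UNIV :: bool set))"
    by (intro finite_cartesian_product finite_PiE) simp_all
  ultimately have "card X \<le> card ((?J \<rightarrow>\<^sub>E {..<N}) \<times> (UNIV :: bool set))"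
    by (rule card_inj_on_le)
  also have "\<dots> = 2 * N ^ (d - 2)"
    using ik by (simp add: card_cartesian_product card_PiE card_Diff_subset numeral_2_eq_2)
  finally show ?thesis .
qed

text \<open>Two equal values with equal signs merge into one unknown with coefficient
  \<open>2\<close> or \<open>- 2\<close>, so the equation determines its double once the other
  values are fixed.\<close>

lemma card_coinciding_le:
  assumes \<sigma>: "\<sigma> \<in> signs d" and ij: "i < d" "j < d" "i \<noteq> j" "\<sigma> i = \<sigma> j"
  shows "card {a \<in> signed_sols N g d \<sigma>. a i = a j} \<le> 2 * N ^ (d - 2)"
proof (rule card_signed_sols_subset_le[OF \<sigma> ij(1-3)])
  fix a b assume ab: "a \<in> {a \<in> signed_sols N g d \<sigma>. a i = a j}" "b \<in> {a \<in> signed_sols N g d \<sigma>. a i = a j}"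
    and agree: "\<And>l. l < d \<Longrightarrow> l \<noteq> i \<Longrightarrow> l \<noteq> j \<Longrightarrow> a l = b l"
  have "int N dvd (\<Sum>l\<in>{i, j}. \<sigma> l * (int (a l) - int (b l)))"
    using signed_sols_dvd_diff[of a N g d \<sigma> b "{i,j}"] ab agree ij by auto
  also have "\<dots> = \<sigma> i * (2 * (int (a i) - int (b i)))" using ij ab by (auto simp: algebra_simps)
  finally show "int N dvd 2 * (int (a i) - int (b i))" using dvd_sign_mult_iff[OF \<sigma> ij(1)] by blast
qed auto

text \<open>The two signings differ at some \<open>i\<close> and agree at some \<open>k\<close>.
  With all other values fixed, subtracting the two congruences eliminates position \<open>k\<close>
  and leaves twice the unknown at \<open>i\<close>.\<close>

lemma card_two_signings_le:
  assumes \<sigma>: "\<sigma> \<in> signs d" "\<tau> \<in> signs d" "\<tau> \<noteq> \<sigma>" "\<tau> \<noteq> neg_signs d \<sigma>"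
  shows "card (signed_sols N g d \<sigma> \<inter> signed_sols N g d \<tau>) \<le> 2 * N ^ (d - 2)"
proof -
  obtain i where i: "i < d" "\<tau> i \<noteq> \<sigma> i"
    using signs_eqI[OF \<sigma>(2,1)] \<sigma>(3) by blast
  then have i': "\<tau> i = - \<sigma> i"
    using signs_cases[OF \<sigma>(1) i(1)] signs_cases[OF \<sigma>(2) i(1)] by auto
  obtain k where k: "k < d" "\<tau> k \<noteq> neg_signs d \<sigma> k"
    using signs_eqI[OF \<sigma>(2) neg_signs_in_signs[OF \<sigma>(1)]] \<sigma>(4) by blast
  then have k': "\<tau> k = \<sigma> k"
    using signs_cases[OF \<sigma>(1) k(1)] signs_cases[OF \<sigma>(2) k(1)] by (auto simp: neg_signs_def)
  have ne: "i \<noteq> k" using i k' by auto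
  show ?thesis
  proof (rule card_signed_sols_subset_le[OF \<sigma>(1) i(1) k(1) ne])
    let ?X = "signed_sols N g d \<sigma> \<inter> signed_sols N g d \<tau>"
    fix a b assume ab: "a \<in> ?X" "b \<in> ?X" and agree: "\<And>l. l < d \<Longrightarrow> l \<noteq> i \<Longrightarrow> l \<noteq> k \<Longrightarrow> a l = b l"
    have "int N dvd (\<Sum>l\<in>{i, k}. \<sigma> l * (int (a l) - int (b l)))"
      using signed_sols_dvd_diff[of a N g d \<sigma> b "{i,k}"] ab agree i k by auto
    then have "int N dvd \<sigma> i * (int (a i) - int (b i)) + \<sigma> k * (int (a k) - int (b k))"
      using ne by simp
    moreover have "int N dvd (\<Sum>l\<in>{i, k}. \<tau> l * (int (a l) - int (b l)))"
      using signed_sols_dvd_diff[of a N g d \<tau> b "{i,k}"] ab agree i k by auto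
    then have "int N dvd - \<sigma> i * (int (a i) - int (b i)) + \<sigma> k * (int (a k) - int (b k))"
      using ne unfolding i'[symmetric] k'[symmetric] by simp
    ultimately have "int N dvd (\<sigma> i * (int (a i) - int (b i)) + \<sigma> k * (int (a k) - int (b k)))
      - (- \<sigma> i * (int (a i) - int (b i)) + \<sigma> k * (int (a k) - int (b k)))"
      by (rule dvd_diff)
    also have "\<dots> = \<sigma> i * (2 * (int (a i) - int (b i)))" by (simp add: algebra_simps)
    finally show "int N dvd 2 * (int (a i) - int (b i))" using dvd_sign_mult_iff[OF \<sigma>(1) i(1)] by blast
  qed auto
qed

section \<open>Solutions with distinct values and essentially one signing\<close>

text \<open>The negated signing has to be tolerated: when \<open>N\<close> divides
  \<open>2 * g\<close>, it is satisfied by every solution for \<open>\<sigma>\<close>.\<close>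

definition good_sols :: "nat \<Rightarrow> nat \<Rightarrow> nat \<Rightarrow> (nat \<Rightarrow> int) \<Rightarrow> (nat \<Rightarrow> nat) set" where
  "good_sols N g d \<sigma> = {a \<in> signed_sols N g d \<sigma>. inj_on a {..<d} \<and>
    (\<forall>\<tau>\<in>signs d. a \<in> signed_sols N g d \<tau> \<longrightarrow> \<tau> = \<sigma> \<or> \<tau> = neg_signs d \<sigma>)}"

text \<open>A coincidence \<open>a i = a j\<close> with opposite signs cancels, so flipping both signs gives a second
  signing. Hence only coincidences with equal signs need a separate count below.\<close>
lemma signed_sols_flip_pair:
  assumes \<sigma>: "\<sigma> \<in> signs d" and a: "a \<in> signed_sols N g d \<sigma>"
    and ij: "i < d" "j < d" "i \<noteq> j" "a i = a j" "\<sigma> i \<noteq> \<sigma> j" and g: "0 < g" "g < N"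
  shows "\<exists>\<tau>\<in>signs d. a \<in> signed_sols N g d \<tau> \<and> \<tau> \<noteq> \<sigma> \<and> \<tau> \<noteq> neg_signs d \<sigma>"
proof -
  define \<tau> where "\<tau> = \<sigma>(i := - \<sigma> i, j := - \<sigma> j)"
  have opp: "\<sigma> j = - \<sigma> i" "\<sigma> i \<noteq> 0" using signs_cases[OF \<sigma> ij(1)] signs_cases[OF \<sigma> ij(2)] ij(5) by auto
  have \<tau>: "\<tau> \<in> signs d"
    using \<sigma> ij unfolding signs_def \<tau>_def by (auto simp: PiE_iff extensional_def)
  have sum: "(\<Sum>l<d. \<rho> l * int (a l)) = (\<Sum>l\<in>{..<d} - {i, j}. \<sigma> l * int (a l))"
    if "\<rho> = \<sigma> \<or> \<rho> = \<tau>" for \<rho>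
  proof -
    have "(\<Sum>l<d. \<rho> l * int (a l)) = (\<Sum>l\<in>{i, j}. \<rho> l * int (a l)) + (\<Sum>l\<in>{..<d} - {i, j}. \<rho> l * int (a l))"
      using sum.subset_diff[of "{i, j}" "{..<d}" "\<lambda>l. \<rho> l * int (a l)"] ij by simp
    also have "(\<Sum>l\<in>{i, j}. \<rho> l * int (a l)) = 0"
      using that ij opp by (auto simp: \<tau>_def)
    also have "(\<Sum>l\<in>{..<d} - {i, j}. \<rho> l * int (a l)) = (\<Sum>l\<in>{..<d} - {i, j}. \<sigma> l * int (a l))"
      using that by (intro sum.cong) (auto simp: \<tau>_def)
    finally show ?thesis by simp
  qed
  have "a \<in> signed_sols N g d \<tau>" using a sum[of \<sigma>] sum[of \<tau>] unfolding signed_sols_def by simp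
  moreover have "\<tau> \<noteq> \<sigma>"
  proof
    assume "\<tau> = \<sigma>"
    then have "\<tau> i = \<sigma> i" by simp
    then show False using opp ij(3) by (simp add: \<tau>_def)
  qed
  moreover have "\<tau> \<noteq> neg_signs d \<sigma>"
  proof
    assume eq: "\<tau> = neg_signs d \<sigma>"
    \<comment> \<open>The two signings agree off \<open>i\<close> and \<open>j\<close>, so the
      negation can only arise if there are no other positions. Then the signed sum vanishes, against
      \<open>g\<close> being nonzero modulo \<open>N\<close>.\<close>
    have "{..<d} - {i, j} = {}"
    proof (rule ccontr)
      assume "{..<d} - {i, j} \<noteq> {}"
      then obtain l where l: "l < d" "l \<noteq> i" "l \<noteq> j" by blast
      then have "\<sigma> l = - \<sigma> l" using fun_cong[OF eq, of l] by (simp add: \<tau>_def neg_signs_def)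
      then show False using signs_cases[OF \<sigma> l(1)] by auto
    qed
    then have "(\<Sum>l<d. \<sigma> l * int (a l)) = 0" using sum[of \<sigma>] by (simp only:) simp
    then have "int N dvd int g" using a unfolding signed_sols_def by simp
    then show False using g by (simp add: nat_dvd_not_less)
  qed
  ultimately show ?thesis using \<tau> by blast
qed

text \<open>A solution that is not good has either a coincidence between equal signs, with at most
  \<open>d * d\<close> pairs of positions, or a further signing, with at most \<open>2 ^ d\<close>
  choices; coincidences between opposite signs fall into the second class. Each class member loses a
  factor of order \<open>N\<close>.\<close>

lemma card_good_sols_ge:
  assumes \<sigma>: "\<sigma> \<in> signs d" and d: "0 < d" and g: "0 < g" "g < N"
  shows "N ^ (d - 1) \<le> card (good_sols N g d \<sigma>) + (d * d + 2 ^ d) * (2 * N ^ (d - 2))"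
proof -
  define I where "I = {(i, j). i < d \<and> j < d \<and> i \<noteq> j \<and> \<sigma> i = \<sigma> j}"
  define R where "R = signs d - {\<sigma>, neg_signs d \<sigma>}"
  let ?X = "\<lambda>(i, j). {a \<in> signed_sols N g d \<sigma>. a i = a j}"
  let ?Y = "\<lambda>\<tau>. signed_sols N g d \<sigma> \<inter> signed_sols N g d \<tau>"
  have I: "I \<subseteq> {..<d} \<times> {..<d}" unfolding I_def by auto
  then have finI: "finite I" by (rule finite_subset) simp
  have cI: "card I \<le> d * d" using card_mono[OF _ I] by (simp add: card_cartesian_product)
  have finR: "finite R" unfolding R_def using finite_signs by blast
  have cR: "card R \<le> 2 ^ d" unfolding R_def using card_mono[OF finite_signs, of _ d] card_signs by (metis Diff_subset)
  have "signed_sols N g d \<sigma> \<subseteq> good_sols N g d \<sigma> \<union> ((\<Union>x\<in>I. ?X x) \<union> (\<Union>\<tau>\<in>R. ?Y \<tau>))"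
  proof
    fix a assume a: "a \<in> signed_sols N g d \<sigma>"
    show "a \<in> good_sols N g d \<sigma> \<union> ((\<Union>x\<in>I. ?X x) \<union> (\<Union>\<tau>\<in>R. ?Y \<tau>))"
    proof (rule ccontr)
      assume n: "\<not> ?thesis"
      then have nR: "\<tau> = \<sigma> \<or> \<tau> = neg_signs d \<sigma>" if "\<tau> \<in> signs d" "a \<in> signed_sols N g d \<tau>" for \<tau>
        using a that unfolding R_def by auto
      then have "\<not> inj_on a {..<d}" using n a unfolding good_sols_def by auto
      then obtain i j where ij: "i < d" "j < d" "i \<noteq> j" "a i = a j" unfolding inj_on_def by auto
      show False
      proof (cases "\<sigma> i = \<sigma> j")
        case True
        then have "(i, j) \<in> I" using ij unfolding I_def by auto
        then show False using n a ij by auto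
      next
        case False
        then show False using signed_sols_flip_pair[OF \<sigma> a ij False g] nR by blast
      qed
    qed
  qed
  then have "card (signed_sols N g d \<sigma>) \<le> card (good_sols N g d \<sigma> \<union> ((\<Union>x\<in>I. ?X x) \<union> (\<Union>\<tau>\<in>R. ?Y \<tau>)))"
    using finI finR finite_signed_sols by (intro card_mono) (auto simp: good_sols_def)
  also have "\<dots> \<le> card (good_sols N g d \<sigma>) + (card (\<Union>x\<in>I. ?X x) + card (\<Union>\<tau>\<in>R. ?Y \<tau>))"
    by (intro order_trans[OF card_Un_le] add_left_mono card_Un_le)
  also have "card (\<Union>x\<in>I. ?X x) \<le> d * d * (2 * N ^ (d - 2))"
  proof -
    have "card (\<Union>x\<in>I. ?X x) \<le> (\<Sum>x\<in>I. card (?X x))" by (rule card_UN_le[OF finI])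
    also have "\<dots> \<le> (\<Sum>x\<in>I. 2 * N ^ (d - 2))"
      by (rule sum_mono) (auto simp: I_def intro: card_coinciding_le[OF \<sigma>])
    also have "\<dots> \<le> d * d * (2 * N ^ (d - 2))" using cI by (simp only: sum_constant of_nat_id mult_le_mono1)
    finally show ?thesis .
  qed
  also have "card (\<Union>\<tau>\<in>R. ?Y \<tau>) \<le> 2 ^ d * (2 * N ^ (d - 2))"
  proof -
    have "card (\<Union>\<tau>\<in>R. ?Y \<tau>) \<le> (\<Sum>\<tau>\<in>R. card (?Y \<tau>))" by (rule card_UN_le[OF finR])
    also have "\<dots> \<le> (\<Sum>\<tau>\<in>R. 2 * N ^ (d - 2))"
      by (rule sum_mono) (rule card_two_signings_le[OF \<sigma>], auto simp: R_def)
    also have "\<dots> \<le> 2 ^ d * (2 * N ^ (d - 2))" using cR by (simp only: sum_constant of_nat_id mult_le_mono1)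
    finally show ?thesis .
  qed
  finally show ?thesis using card_signed_sols_ge[OF \<sigma> d, of N g] g by (simp add: algebra_simps)
qed

section \<open>The number of representing sets\<close>

lemma rep_sets_subset: "rep_sets N g d \<subseteq> {A. A \<subseteq> {..<N} \<and> card A = d}"
  unfolding rep_sets_def using signed_sols_less by (auto simp: card_image)

lemma finite_rep_sets: "finite (rep_sets N g d)"
  by (rule finite_subset[OF rep_sets_subset], rule finite_subset[of _ "Pow {..<N}"]) auto

lemma card_injections_same_card:
  assumes "finite A" "card A = d"
  shows "card {a \<in> {..<d} \<rightarrow>\<^sub>E A. inj_on a {..<d}} = fact d"
proof -
  have "card {a \<in> {..<d} \<rightarrow>\<^sub>E A. inj_on a {..<d}} = prod ((-) d) {0..<d}"
    using assms by (subst card_inj_on_subset_funcset) auto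
  also have "\<dots> = fact d" by (simp add: fact_prod_rev)
  finally show ?thesis .
qed

text \<open>Adding the two congruences cancels the signed sums and leaves
  \<open>- 2 * g\<close>.\<close>

lemma signed_sols_neg_dvd:
  assumes "a \<in> signed_sols N g d \<sigma>" "a \<in> signed_sols N g d (neg_signs d \<sigma>)"
  shows "N dvd 2 * g"
proof -
  have "(\<Sum>i<d. neg_signs d \<sigma> i * int (a i)) = - (\<Sum>i<d. \<sigma> i * int (a i))"
    by (simp add: neg_signs_def sum_negf)
  then have "int N dvd ((\<Sum>i<d. \<sigma> i * int (a i)) - int g) + (- (\<Sum>i<d. \<sigma> i * int (a i)) - int g)"
    using assms unfolding signed_sols_def by (intro dvd_add[of "int N"]) auto
  then have "int N dvd - int (2 * g)" by simp
  then show ?thesis by (simp only: dvd_minus_iff of_nat_dvd_iff)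
qed

lemma card_signings_good_le:
  "card {\<sigma> \<in> signs d. a \<in> good_sols N g d \<sigma>} \<le> (if N dvd 2 * g then 2 else 1)"
proof (cases "{\<sigma> \<in> signs d. a \<in> good_sols N g d \<sigma>} = {}")
  case False
  then obtain \<sigma> where \<sigma>: "\<sigma> \<in> signs d" "a \<in> good_sols N g d \<sigma>" by blast
  then have sub: "{\<tau> \<in> signs d. a \<in> good_sols N g d \<tau>} \<subseteq> {\<sigma>, neg_signs d \<sigma>}"
    unfolding good_sols_def by blast
  show ?thesis
  proof (cases "N dvd 2 * g")
    case True
    have "card {\<tau> \<in> signs d. a \<in> good_sols N g d \<tau>} \<le> card {\<sigma>, neg_signs d \<sigma>}"
      by (rule card_mono[OF _ sub]) simp
    also have "\<dots> \<le> 2" by (simp add: card_insert_if)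
    finally show ?thesis using True by simp
  next
    case False
    then have "{\<tau> \<in> signs d. a \<in> good_sols N g d \<tau>} \<subseteq> {\<sigma>}"
      using sub \<sigma> signed_sols_neg_dvd[of a N g d \<sigma>] unfolding good_sols_def by blast
    then have "card {\<tau> \<in> signs d. a \<in> good_sols N g d \<tau>} \<le> card {\<sigma>}"
      by (rule card_mono[rotated]) simp
    then show ?thesis using False by simp
  qed
next
  case True
  then show ?thesis by (simp only: card.empty)
qed

text \<open>Double counting of pairs of a signing and a good solution. A set is the image of at most
  \<open>fact d\<close> injective tuples, and each tuple is good for one signing, or for two when
  \<open>N\<close> divides \<open>2 * g\<close>.\<close>

lemma card_rep_sets_ge:
  assumes d: "0 < d" and g: "0 < g" "g < N"
  shows "2 ^ d * N ^ (d - 1) \<le> (if N dvd 2 * g then 2 else 1) * fact d * card (rep_sets N g d) +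
    2 ^ d * ((d * d + 2 ^ d) * (2 * N ^ (d - 2)))"
proof -
  define m :: nat where "m = (if N dvd 2 * g then 2 else 1)"
  define G where "G = (SIGMA \<sigma>:signs d. good_sols N g d \<sigma>)"
  have fing: "finite (good_sols N g d \<sigma>)" for \<sigma>
    using finite_signed_sols[of N g d \<sigma>] by (rule rev_finite_subset) (auto simp: good_sols_def)
  have finG: "finite G" unfolding G_def using finite_signs fing by blast
  let ?h = "\<lambda>x. snd x ` {..<d}"
  have fiber: "card {x \<in> G. ?h x = A} \<le> m * fact d" if "A \<in> rep_sets N g d" for A
  proof -
    have A: "finite A" "card A = d" using that rep_sets_subset finite_subset[of A "{..<N}"] by blast+
    let ?B = "{a \<in> {..<d} \<rightarrow>\<^sub>E A. inj_on a {..<d}}"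
    let ?S = "SIGMA a:?B. {\<sigma> \<in> signs d. a \<in> good_sols N g d \<sigma>}"
    have finB: "finite ?B" using A by (intro finite_subset[of ?B "{..<d} \<rightarrow>\<^sub>E A"] finite_PiE) auto
    \<comment> \<open>The swap sorts the fibre by tuple first, so that the signings can be counted
      for each tuple separately.\<close>
    have "prod.swap ` {x \<in> G. ?h x = A} \<subseteq> ?S"
      unfolding G_def good_sols_def signed_sols_def by (auto simp: PiE_iff)
    moreover have "finite ?S" using finB finite_signs by auto
    ultimately have "card {x \<in> G. ?h x = A} \<le> card ?S"
      by (intro card_inj_on_le[of prod.swap]) (auto simp: inj_on_def)
    also have "\<dots> = (\<Sum>a\<in>?B. card {\<sigma> \<in> signs d. a \<in> good_sols N g d \<sigma>})"
      using finB finite_signs by (intro card_SigmaI) auto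
    also have "\<dots> \<le> (\<Sum>a\<in>?B. m)"
      unfolding m_def by (rule sum_mono) (rule card_signings_good_le)
    also have "\<dots> = m * fact d" using card_injections_same_card[OF A] by simp
    finally show ?thesis .
  qed
  have img: "?h ` G \<subseteq> rep_sets N g d"
    unfolding G_def rep_sets_def good_sols_def by auto
  have "card G = (\<Sum>A\<in>rep_sets N g d. card {x \<in> G. ?h x = A})"
    using sum.group[OF finG finite_rep_sets img, of "\<lambda>_. 1 :: nat"] by simp
  also have "\<dots> \<le> (\<Sum>A\<in>rep_sets N g d. m * fact d)" by (rule sum_mono) (rule fiber)
  finally have G: "card G \<le> m * fact d * card (rep_sets N g d)" by (simp add: mult_ac)
  have "2 ^ d * N ^ (d - 1) = (\<Sum>\<sigma>\<in>signs d. N ^ (d - 1))" by (simp add: card_signs)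
  also have "\<dots> \<le> (\<Sum>\<sigma>\<in>signs d. card (good_sols N g d \<sigma>) + (d * d + 2 ^ d) * (2 * N ^ (d - 2)))"
    by (rule sum_mono) (rule card_good_sols_ge[OF _ d g])
  also have "\<dots> = card G + 2 ^ d * ((d * d + 2 ^ d) * (2 * N ^ (d - 2)))"
    unfolding G_def using fing finite_signs by (subst card_SigmaI) (auto simp: sum.distrib card_signs)
  finally show ?thesis using G unfolding m_def by linarith
qed

section \<open>Intersecting pairs of representing sets\<close>

text \<open>The positions in \<open>T\<close> have at most \<open>d\<close> choices each, one
  position outside \<open>T\<close> is determined by the equation, and the remaining ones are
  free.\<close>

lemma card_sols_into_le:
  assumes \<sigma>: "\<sigma> \<in> signs d" and T: "T \<subseteq> {..<d}" "card T < d" and A: "finite A" "card A \<le> d"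
  shows "card {a \<in> signed_sols N g d \<sigma>. a ` T \<subseteq> A} \<le> d ^ d * N ^ (d - card T - 1)"
proof -
  have "T \<noteq> {..<d}" using T(2) by auto
  then obtain k where k: "k < d" "k \<notin> T" using T by auto
  let ?J = "{..<d} - {k}"
  define V where "V i = (if i \<in> T then A else {..<N})" for i
  let ?X = "{a \<in> signed_sols N g d \<sigma>. a ` T \<subseteq> A}"
  have finT: "finite T" using T finite_subset by blast
  have "inj_on (\<lambda>a. restrict a ?J) ?X"
  proof
    fix a b assume ab: "a \<in> ?X" "b \<in> ?X" "restrict a ?J = restrict b ?J"
    show "a = b"
    proof (rule signed_sols_determined[OF \<sigma> k(1)])
      show "a i = b i" if "i < d" "i \<noteq> k" for i
        using fun_cong[OF ab(3), of i] that by simp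
    qed (use ab in auto)
  qed
  moreover have "(\<lambda>a. restrict a ?J) ` ?X \<subseteq> PiE ?J V"
  proof -
    have "restrict a ?J \<in> PiE ?J V" if "a \<in> ?X" for a
      using that signed_sols_less[of a N g d \<sigma>] unfolding restrict_PiE_iff V_def by auto
    then show ?thesis by blast
  qed
  moreover have "finite (PiE ?J V)" using A by (intro finite_PiE) (auto simp: V_def)
  ultimately have "card ?X \<le> card (PiE ?J V)" by (rule card_inj_on_le)
  also have "\<dots> = (\<Prod>i\<in>?J. card (V i))" by (simp add: card_PiE)
  also have "\<dots> = (\<Prod>i\<in>?J - T. card (V i)) * (\<Prod>i\<in>T. card (V i))"
    using T k by (intro prod.subset_diff) auto
  also have "(\<Prod>i\<in>?J - T. card (V i)) = N ^ card (?J - T)" by (simp add: V_def)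
  also have "card (?J - T) = d - card T - 1"
  proof -
    have "?J - T = ({..<d} - T) - {k}" by auto
    then show ?thesis using k T finT by (simp add: card_Diff_subset)
  qed
  also have "(\<Prod>i\<in>T. card (V i)) = card A ^ card T" by (simp add: V_def)
  also have "card A ^ card T \<le> d ^ d"
  proof -
    have "card A ^ card T \<le> d ^ card T" using A by (intro power_mono) auto
    also have "\<dots> \<le> d ^ d" using T by (intro power_increasing) auto
    finally show ?thesis .
  qed
  finally show ?thesis by (simp add: mult_ac)
qed

text \<open>The \<open>m\<close> new elements are tied by one equation, whence the exponent
  \<open>m - 1\<close>. The factor \<open>4 ^ d\<close> counts the signing together with the set of
  positions whose values lie in \<open>A\<close>.\<close>

lemma card_rep_sets_diff_le:
  assumes A: "finite A" "card A \<le> d" and m: "0 < m"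
  shows "card {B \<in> rep_sets N g d. card (B - A) = m} \<le> 4 ^ d * d ^ d * N ^ (m - 1)"
proof -
  define W where "W = {T. T \<subseteq> {..<d} \<and> card T < d \<and> d - card T = m}"
  have W: "W \<subseteq> Pow {..<d}" unfolding W_def by auto
  then have finW: "finite W" by (rule finite_subset) simp
  have cW: "card W \<le> 2 ^ d" using card_mono[OF _ W] by (simp add: card_Pow)
  let ?X = "\<lambda>(\<sigma>, T). (\<lambda>a. a ` {..<d}) ` {a \<in> signed_sols N g d \<sigma>. a ` T \<subseteq> A}"
  have "{B \<in> rep_sets N g d. card (B - A) = m} \<subseteq> (\<Union>x\<in>signs d \<times> W. ?X x)"
  proof
    fix B assume "B \<in> {B \<in> rep_sets N g d. card (B - A) = m}"
    then obtain \<sigma> a where a: "\<sigma> \<in> signs d" "a \<in> signed_sols N g d \<sigma>" "inj_on a {..<d}" "B = a ` {..<d}"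
      and cm: "card (B - A) = m" unfolding rep_sets_def by blast
    define T where "T = {i\<in>{..<d}. a i \<in> A}"
    have "B - A = a ` ({..<d} - T)" unfolding a(4) T_def by auto
    then have "card (B - A) = card ({..<d} - T)"
      using a(3) by (simp add: card_image inj_on_diff)
    also have "\<dots> = d - card T" by (subst card_Diff_subset) (auto simp: T_def)
    finally have "T \<in> W" using cm m unfolding W_def T_def by auto
    moreover have "a ` T \<subseteq> A" unfolding T_def by auto
    ultimately show "B \<in> (\<Union>x\<in>signs d \<times> W. ?X x)" using a by blast
  qed
  moreover have "finite (\<Union>x\<in>signs d \<times> W. ?X x)"
    using finite_signs finW finite_signed_sols by auto
  ultimately have "card {B \<in> rep_sets N g d. card (B - A) = m} \<le> card (\<Union>x\<in>signs d \<times> W. ?X x)"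
    by (intro card_mono)
  also have "\<dots> \<le> (\<Sum>x\<in>signs d \<times> W. card (?X x))"
    by (rule card_UN_le) (use finite_signs finW in auto)
  also have "\<dots> \<le> (\<Sum>x\<in>signs d \<times> W. d ^ d * N ^ (m - 1))"
  proof (rule sum_mono)
    fix x assume "x \<in> signs d \<times> W"
    then obtain \<sigma> T where x: "x = (\<sigma>, T)" "\<sigma> \<in> signs d" "T \<in> W" by auto
    have "card (?X x) \<le> card {a \<in> signed_sols N g d \<sigma>. a ` T \<subseteq> A}"
      unfolding x(1) prod.case by (rule card_image_le) (simp add: finite_signed_sols)
    also have "\<dots> \<le> d ^ d * N ^ (d - card T - 1)"
      using x A by (intro card_sols_into_le) (auto simp: W_def)
    finally show "card (?X x) \<le> d ^ d * N ^ (m - 1)" using x(3) unfolding W_def by auto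
  qed
  also have "\<dots> = 2 ^ d * card W * (d ^ d * N ^ (m - 1))"
    by (simp add: card_cartesian_product card_signs)
  also have "\<dots> \<le> 2 ^ d * 2 ^ d * (d ^ d * N ^ (m - 1))"
    using cW by (intro mult_le_mono) auto
  also have "\<dots> = 4 ^ d * d ^ d * N ^ (m - 1)"
    using power_mult_distrib[of "2::nat" 2 d] by simp
  finally show ?thesis .
qed

text \<open>The sets are grouped by the number \<open>m\<close> of elements outside
  \<open>A\<close>. Each group contributes a multiple of \<open>(real N * p) ^ m / real N\<close>,
  and since \<open>real N * p\<close> is at least \<open>1\<close> the case \<open>m = d - 1\<close>
  dominates.\<close>

lemma rep_sets_dependency:
  assumes A: "A \<in> rep_sets N g d" and p: "0 \<le> p" and N: "0 < N" and Np: "1 \<le> real N * p"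
  shows "(\<Sum>B\<in>{B \<in> rep_sets N g d. B \<noteq> A \<and> B \<inter> A \<noteq> {}}. p ^ card (B - A)) \<le>
    4 ^ d * real d ^ d * (real d * (real N * p) ^ (d - 1) / real N)"
proof -
  let ?S = "{B \<in> rep_sets N g d. B \<noteq> A \<and> B \<inter> A \<noteq> {}}"
  have fin: "finite B" "card B = d" if "B \<in> rep_sets N g d" for B
    using that rep_sets_subset finite_subset[of B "{..<N}"] by blast+
  have finS: "finite ?S" using finite_rep_sets by simp
  have img: "(\<lambda>B. card (B - A)) ` ?S \<subseteq> {1..<d}"
  proof (rule image_subsetI)
    fix B assume B: "B \<in> ?S"
    then have fB: "finite B" "card B = d" using fin by auto
    have "B - A \<noteq> {}"
    proof
      assume "B - A = {}"
      then have "B \<subseteq> A" by blast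
      then have "B = A" using card_subset_eq[of A B] fin[OF A] fB by simp
      then show False using B by simp
    qed
    then have "0 < card (B - A)" using fB by (simp add: card_gt_0_iff)
    moreover have "card (B - A) < card B" using B fB by (intro psubset_card_mono) auto
    ultimately show "card (B - A) \<in> {1..<d}" using fB by simp
  qed
  have "(\<Sum>B\<in>?S. p ^ card (B - A)) = (\<Sum>m\<in>{1..<d}. \<Sum>B\<in>{B \<in> ?S. card (B - A) = m}. p ^ card (B - A))"
    using sum.group[OF finS _ img, of "\<lambda>B. p ^ card (B - A)"] by simp
  also have "\<dots> \<le> (\<Sum>m\<in>{1..<d}. 4 ^ d * real d ^ d * ((real N * p) ^ (d - 1) / real N))"
  proof (rule sum_mono)
    fix m assume m: "m \<in> {1..<d}"
    have "(\<Sum>B\<in>{B \<in> ?S. card (B - A) = m}. p ^ card (B - A)) = real (card {B \<in> ?S. card (B - A) = m}) * p ^ m"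
      by simp
    also have "card {B \<in> ?S. card (B - A) = m} \<le> card {B \<in> rep_sets N g d. card (B - A) = m}"
      using finite_rep_sets by (intro card_mono) auto
    also have "\<dots> \<le> 4 ^ d * d ^ d * N ^ (m - 1)"
      using fin[OF A] m by (intro card_rep_sets_diff_le) auto
    finally have "(\<Sum>B\<in>{B \<in> ?S. card (B - A) = m}. p ^ card (B - A)) \<le> real (4 ^ d * d ^ d * N ^ (m - 1)) * p ^ m"
      using p by (simp add: mult_right_mono)
    also have "\<dots> = 4 ^ d * real d ^ d * ((real N * p) ^ m / real N)"
      using N m by (cases m) (auto simp: field_simps power_mult_distrib)
    also have "\<dots> \<le> 4 ^ d * real d ^ d * ((real N * p) ^ (d - 1) / real N)"
      using m Np by (intro mult_left_mono divide_right_mono power_increasing) auto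
    finally show "(\<Sum>B\<in>{B \<in> ?S. card (B - A) = m}. p ^ card (B - A)) \<le>
      4 ^ d * real d ^ d * ((real N * p) ^ (d - 1) / real N)" .
  qed
  also have "\<dots> = real (d - 1) * (4 ^ d * real d ^ d * ((real N * p) ^ (d - 1) / real N))" by simp
  also have "\<dots> \<le> real d * (4 ^ d * real d ^ d * ((real N * p) ^ (d - 1) / real N))"
    using p by (intro mult_right_mono) auto
  finally show ?thesis by (simp add: mult_ac)
qed

subsection \<open>From representations to walks\<close>

lemma cyc_inv_mult_eqI:
  assumes "x < N" "0 < N" "a < N" "int N dvd int x + int a - int y" "y < N"
  shows "cyc_inv_mult N x y = a"
proof -
  have "int (y + N - x) = int y + int N - int x" using assms by simp
  then have "int a - int (y + N - x) = (int x + int a - int y) - int N" by simp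
  then have "int N dvd int a - int (y + N - x)" using assms(4) by (metis dvd_diff dvd_refl)
  then have "int a mod int N = int (y + N - x) mod int N" by (simp only: mod_eq_dvd_iff)
  then have "a mod N = (y + N - x) mod N" by (metis of_nat_eq_iff of_nat_mod)
  then show ?thesis using assms unfolding cyc_inv_mult_def by simp
qed

text \<open>The partial sums are the successive vertices of the walk; a negative sign uses an edge
  in the reverse direction.\<close>

lemma cayley_walk_signed_sum:
  assumes u: "u < N" and \<sigma>: "\<sigma> \<in> signs d" and a: "\<And>i. i < d \<Longrightarrow> a i \<in> S \<and> a i < N" and "n \<le> d"
  shows "\<exists>k\<le>n. cayley_walk N S k u (nat ((int u + (\<Sum>i<n. \<sigma> i * int (a i))) mod int N))"
  using \<open>n \<le> d\<close>
proof (induction n)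
  case 0
  then show ?case using u by (auto simp: nat_mod_distrib)
next
  case (Suc n)
  define s where "s n = int u + (\<Sum>i<n. \<sigma> i * int (a i))" for n
  define w where "w n = nat (s n mod int N)" for n
  have wint: "int (w n) = s n mod int N" and wl: "w n < N" for n
    using u unfolding w_def by (simp_all add: nat_less_iff)
  obtain k where k: "k \<le> n" "cayley_walk N S k u (w n)"
    using Suc unfolding w_def s_def by auto
  have n: "n < d" using Suc by simp
  have step: "s (Suc n) = s n + \<sigma> n * int (a n)" unfolding s_def by simp
  have wdvd: "int N dvd int (w n) - s n" for n unfolding wint by (simp add: mod_eq_dvd_iff[symmetric])
  have D: "int N dvd (int (w n) - s n) - (int (w (Suc n)) - s (Suc n))"
    by (rule dvd_diff[OF wdvd wdvd])
  show ?case
  \<comment> \<open>Adding the zero residue gives no edge, since loops are excluded; the walk then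
    stays put, which is why its length is only bounded by \<open>n\<close>.\<close>
  proof (cases "w (Suc n) = w n")
    case True
    then show ?thesis using k unfolding w_def s_def by (intro exI[of _ k]) auto
  next
    case False
    have "cayley_adj N S (w n) (w (Suc n))"
    proof (cases "\<sigma> n = 1")
      case True
      have "int N dvd int (w n) + int (a n) - int (w (Suc n))" using D by (simp add: step True algebra_simps)
      then have "cyc_inv_mult N (w n) (w (Suc n)) = a n"
        using u a[OF n] by (intro cyc_inv_mult_eqI wl) auto
      then show ?thesis using a[OF n] wl False unfolding cayley_adj_def by auto
    next
      case neg: False
      then have neg: "\<sigma> n = - 1" using signs_cases[OF \<sigma> n] by simp
      have "int N dvd - (int (w (Suc n)) + int (a n) - int (w n))" using D by (simp add: step neg algebra_simps)
      then have "int N dvd int (w (Suc n)) + int (a n) - int (w n)" by (simp only: dvd_minus_iff)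
      then have "cyc_inv_mult N (w (Suc n)) (w n) = a n"
        using u a[OF n] by (intro cyc_inv_mult_eqI wl) auto
      then show ?thesis using a[OF n] wl False unfolding cayley_adj_def by auto
    qed
    then have "cayley_walk N S (Suc k) u (w (Suc n))" using k wl by auto
    then show ?thesis using k unfolding w_def s_def by (intro exI[of _ "Suc k"]) auto
  qed
qed

text \<open>Whether \<open>v\<close> can be reached from \<open>u\<close> by signed elements depends
  only on the difference \<open>v - u\<close> modulo \<open>N\<close>.\<close>

lemma cayley_diam_le:
  assumes "\<And>g. 0 < g \<Longrightarrow> g < N \<Longrightarrow> \<exists>A\<in>rep_sets N g d. A \<subseteq> S"
  shows "cayley_diam N S \<le> enat d"
proof -
  have "cayley_dist N S u v \<le> enat d" if uv: "u < N" "v < N" for u v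
  proof -
    have "\<exists>k\<le>d. cayley_walk N S k u v"
    proof (cases "u = v")
      case True
      then show ?thesis by (intro exI[of _ 0]) simp
    next
      case False
      define g where "g = nat ((int v - int u) mod int N)"
      have gi: "int g = (int v - int u) mod int N" using uv unfolding g_def by simp
      have gN: "g < N" using uv unfolding g_def by (simp add: nat_less_iff)
      have "g \<noteq> 0"
      proof
        assume "g = 0"
        then have "int N dvd int v - int u" using gi by (simp add: dvd_eq_mod_eq_0)
        then show False using eq_if_dvd_diff uv False by blast
      qed
      then obtain A where "A \<in> rep_sets N g d" "A \<subseteq> S" using assms gN by blast
      then obtain \<sigma> a where a: "\<sigma> \<in> signs d" "a \<in> signed_sols N g d \<sigma>" "a ` {..<d} \<subseteq> S"
        unfolding rep_sets_def by blast
      have dv: "int N dvd (\<Sum>i<d. \<sigma> i * int (a i)) - int g" using a(2) unfolding signed_sols_def by blast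
      have "int N dvd int g - (int v - int u)" unfolding gi by (simp add: mod_eq_dvd_iff[symmetric])
      then have "int N dvd ((\<Sum>i<d. \<sigma> i * int (a i)) - int g) + (int g - (int v - int u))"
        using dv by (rule dvd_add[rotated])
      then have "int N dvd (int u + (\<Sum>i<d. \<sigma> i * int (a i))) - int v" by (simp add: algebra_simps)
      then have "(int u + (\<Sum>i<d. \<sigma> i * int (a i))) mod int N = int v mod int N"
        by (simp only: mod_eq_dvd_iff)
      then have "nat ((int u + (\<Sum>i<d. \<sigma> i * int (a i))) mod int N) = v" using uv by simp
      then show ?thesis
        using cayley_walk_signed_sum[OF uv(1) a(1), of a S d] a signed_sols_less[OF a(2)] by auto
    qed
    then obtain k where "k \<le> d" "cayley_walk N S k u v" by blast
    then show ?thesis unfolding cayley_dist_def by (intro INF_lower2[of k]) auto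
  qed
  then show ?thesis unfolding cayley_diam_def by (intro SUP_least) auto
qed

subsection \<open>Estimates at the threshold\<close>

text \<open>\<open>\<Lambda>\<close> is the main term of the expected number of representing sets
  inside the random set. The single error \<open>\<theta>\<close> absorbs both the dependency bound
  in Janson's inequality and the relative loss from solutions that are not good.\<close>

lemma prob_no_rep_set_le:
  assumes g: "0 < g" "g < N" and d: "2 \<le> d" and p: "0 \<le> p" "p \<le> 1" and Np: "1 \<le> real N * p"
  defines "\<Lambda> \<equiv> 2 ^ d * real N ^ (d - 1) * p ^ d / fact d"
  assumes \<eta>: "4 ^ d * real d ^ d * (real d * (real N * p) ^ (d - 1) / real N) \<le> \<theta>"
    and \<kappa>: "2 * (real d * real d + 2 ^ d) / real N \<le> \<theta>" and \<theta>: "\<theta> \<le> 1"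
  shows "measure_pmf.prob (random_subset {0..<N} p) {f. \<forall>A\<in>rep_sets N g d. \<exists>x\<in>A. \<not> f x} \<le>
    exp (- ((1 - \<theta>) * ((1 - \<theta>) * \<Lambda>) / (if N dvd 2 * g then 2 else 1)))"
proof -
  define m :: nat where "m = (if N dvd 2 * g then 2 else 1)"
  have N: "real N > 0" using g by simp
  have m: "real m > 0" unfolding m_def by simp
  have "real (2 ^ d * N ^ (d - 1)) \<le> real (m * fact d * card (rep_sets N g d) + 2 ^ d * ((d * d + 2 ^ d) * (2 * N ^ (d - 2))))"
    unfolding of_nat_le_iff m_def using card_rep_sets_ge[OF _ g] d by simp
  then have 1: "2 ^ d * real N ^ (d - 1) - 2 ^ d * ((real d * real d + 2 ^ d) * (2 * real N ^ (d - 2)))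
      \<le> real m * fact d * card (rep_sets N g d)" by simp
  \<comment> \<open>Turns the error term of the count into a relative error of at most
    \<open>\<theta>\<close>.\<close>
  have "real N ^ (d - 1) = real N * real N ^ (d - 2)"
    using d by (metis Suc_1 Suc_diff_le diff_Suc_Suc power_Suc)
  then have "2 ^ d * real N ^ (d - 1) * (2 * (real d * real d + 2 ^ d) / real N) =
      2 ^ d * ((real d * real d + 2 ^ d) * (2 * real N ^ (d - 2)))"
    using N by simp
  moreover have "2 ^ d * real N ^ (d - 1) * (2 * (real d * real d + 2 ^ d) / real N) \<le> 2 ^ d * real N ^ (d - 1) * \<theta>"
    using \<kappa> by (intro mult_left_mono) auto
  ultimately have "(1 - \<theta>) * (2 ^ d * real N ^ (d - 1)) \<le> real m * fact d * card (rep_sets N g d)"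
    using 1 by (simp add: algebra_simps)
  then have "(1 - \<theta>) * (2 ^ d * real N ^ (d - 1)) * p ^ d \<le> real m * fact d * card (rep_sets N g d) * p ^ d"
    using p by (intro mult_right_mono) auto
  then have \<mu>: "(1 - \<theta>) * \<Lambda> / m \<le> card (rep_sets N g d) * p ^ d"
    unfolding \<Lambda>_def using m by (simp add: field_simps)
  have cards: "(\<Sum>A\<in>rep_sets N g d. p ^ card A) = card (rep_sets N g d) * p ^ d"
  proof -
    have "(\<Sum>A\<in>rep_sets N g d. p ^ card A) = (\<Sum>A\<in>rep_sets N g d. p ^ d)"
      by (rule sum.cong) (use rep_sets_subset in auto)
    then show ?thesis by simp
  qed
  have "measure_pmf.prob (random_subset {0..<N} p) {f. \<forall>A\<in>rep_sets N g d. \<exists>x\<in>A. \<not> f x} \<le>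
      exp (- ((1 - \<theta>) * (\<Sum>A\<in>rep_sets N g d. p ^ card A)))"
  proof (rule Janson_inequality)
    show "rep_sets N g d \<subseteq> Pow {0..<N}" using rep_sets_subset[of N g d] by fastforce
    show "(\<Sum>B\<in>{B \<in> rep_sets N g d. B \<noteq> A \<and> B \<inter> A \<noteq> {}}. p ^ card (B - A)) \<le> \<theta>"
      if "A \<in> rep_sets N g d" for A
      using rep_sets_dependency[OF that p(1) _ Np] g \<eta> by linarith
  qed (use p in auto)
  also have "\<dots> \<le> exp (- ((1 - \<theta>) * ((1 - \<theta>) * \<Lambda> / m)))"
    unfolding cards exp_le_cancel_iff neg_le_iff_le using \<mu> \<theta> by (intro mult_left_mono) auto
  finally show ?thesis unfolding m_def by (cases "N dvd 2 * g") simp_all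
qed

text \<open>Here \<open>lam\<close> stands for \<open>N\<close> times the threshold probability. The
  bound on \<open>d\<close> says that \<open>L ^ (2 * d * d)\<close> is at most \<open>N\<close>, so
  \<open>lam\<close> is at least of order \<open>L ^ (2 * d)\<close>, while the combinatorial
  factors amount to at most \<open>(4 * L) ^ d\<close>.\<close>

lemma threshold_estimates:
  fixes N d :: nat and \<epsilon> L lam :: real
  assumes \<epsilon>: "0 < \<epsilon>" and N: "0 < N" and L: "L = ln (real N)" "4 \<le> L" and d: "2 \<le> d"
    and dL: "real d * real d \<le> L / (2 * ln L)"
    and lam: "0 \<le> lam" "lam ^ d = real N * (fact d * (1 + \<epsilon>) / 2 ^ d * L)"
  shows "1 \<le> lam"
    and "4 ^ d * real d ^ d * (real d * lam ^ (d - 1) / real N) \<le> 32 * (1 + \<epsilon>) / L"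
    and "2 * (real d * real d + 2 ^ d) / real N \<le> 64 / L"
proof -
  have lnL: "1 \<le> ln L" using L(2) exp_le by (subst ln_ge_iff) auto
  have "L / (2 * ln L) \<le> L / 1" using lnL L(2) by (intro divide_left_mono) auto
  then have ddL: "real d * real d \<le> L" using dL by simp
  have "real (2 * d * d) * ln L \<le> L" using dL lnL by (simp add: field_simps)
  then have "exp (real (2 * d * d) * ln L) \<le> exp L" by simp
  moreover have "exp (real (2 * d * d) * ln L) = L ^ (2 * d * d)"
    using L(2) by (simp only: exp_of_nat_mult exp_ln)
  moreover have "exp L = real N" using L(1) N by simp
  ultimately have LN: "L ^ (2 * d * d) \<le> real N" by simp
  \<comment> \<open>Both error terms reduce to \<open>(4 / L) ^ d\<close>; \<open>d \<ge> 2\<close>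
    makes this small enough to absorb a further factor \<open>L\<close>.\<close>
  have sd: "(4 / L) ^ d \<le> 16 / L\<^sup>2"
  proof -
    have "(4 / L) ^ d \<le> (4 / L) ^ 2" using L(2) d by (intro power_decreasing) auto
    then show ?thesis by (simp add: power_divide)
  qed
  have f1: "(1::real) \<le> fact d * (1 + \<epsilon>) * L"
    using \<epsilon> L(2) fact_ge_1[of d, where 'a = real] by (intro mult_ge1_I) auto
  have "real N * 1 \<le> real N * (fact d * (1 + \<epsilon>) * L)" using f1 by (intro mult_left_mono) auto
  also have "\<dots> = (2 * lam) ^ d" using lam(2) by (simp add: power_mult_distrib)
  finally have "(L ^ (2 * d)) ^ d \<le> (2 * lam) ^ d"
    using LN by (simp add: power_mult[symmetric])
  then have lam2: "L ^ (2 * d) \<le> 2 * lam"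
    using lam(1) d by (subst (asm) power_mono_iff) (use L(2) in auto)
  have "L ^ 1 \<le> L ^ (2 * d)" using L(2) d by (intro power_increasing) auto
  then show lam1: "1 \<le> lam" using lam2 L(2) by simp
  have "real d \<le> 2 ^ d" using less_exp[of d] by (metis less_imp_le of_nat_le_iff of_nat_numeral of_nat_power)
  have "lam ^ d = lam * lam ^ (d - 1)" using d by (cases d) auto
  then have "lam ^ (d - 1) / real N = fact d * (1 + \<epsilon>) / 2 ^ d * L / lam"
    using lam lam1 N by (simp add: field_simps)
  then have "4 ^ d * real d ^ d * (real d * (lam ^ (d - 1) / real N)) =
      4 ^ d * real d ^ d * (real d * (fact d * (1 + \<epsilon>) / 2 ^ d * L / lam))"
    by simp
  then have "4 ^ d * real d ^ d * (real d * lam ^ (d - 1) / real N) =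
      (4 ^ d / 2 ^ d) * real d ^ d * real d * fact d * ((1 + \<epsilon>) * L / lam)"
    by (simp add: mult_ac)
  also have "(4::real) ^ d / 2 ^ d = 2 ^ d" by (simp add: power_divide[symmetric])
  \<comment> \<open>The lone \<open>d\<close> is replaced by \<open>2 ^ d\<close> and the factorial
    by \<open>d ^ d\<close>, so that everything combines into
    \<open>(4 * d * d) ^ d\<close>.\<close>
  also have "2 ^ d * real d ^ d * real d * fact d * ((1 + \<epsilon>) * L / lam) \<le>
      2 ^ d * real d ^ d * 2 ^ d * real d ^ d * ((1 + \<epsilon>) * L / (L ^ (2 * d) / 2))"
  proof (intro mult_mono divide_left_mono)
    show "fact d \<le> real d ^ d" using fact_le_power[of d, where 'a = real] by simp
    show "L ^ (2 * d) / 2 \<le> lam" using lam2 by simp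
  qed (use \<open>real d \<le> 2 ^ d\<close> \<epsilon> L(2) lam1 in auto)
  also have "\<dots> = 4 ^ d * (real d * real d) ^ d * ((1 + \<epsilon>) * L / (L ^ (2 * d) / 2))"
  proof -
    have "(4::real) ^ d = 2 ^ d * 2 ^ d" by (simp add: power_mult_distrib[symmetric])
    then show ?thesis by (simp add: power_mult_distrib)
  qed
  also have "\<dots> \<le> 4 ^ d * L ^ d * ((1 + \<epsilon>) * L / (L ^ (2 * d) / 2))"
    using ddL \<epsilon> L(2) by (intro mult_right_mono mult_left_mono power_mono) auto
  also have "\<dots> = 2 * (1 + \<epsilon>) * L * (4 / L) ^ d"
    using L(2) by (simp add: field_simps power_mult power2_eq_square power_mult_distrib)
  also have "\<dots> \<le> 2 * (1 + \<epsilon>) * L * (16 / L\<^sup>2)"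
    using sd \<epsilon> L(2) by (intro mult_left_mono) auto
  also have "\<dots> = 32 * (1 + \<epsilon>) / L" using L(2) by (simp add: field_simps power2_eq_square)
  finally show "4 ^ d * real d ^ d * (real d * lam ^ (d - 1) / real N) \<le> 32 * (1 + \<epsilon>) / L" .
  have "real d * real d \<le> 2 ^ d * 2 ^ d" using \<open>real d \<le> 2 ^ d\<close> by (intro mult_mono) auto
  also have "\<dots> = (4::real) ^ d" by (simp add: power_mult_distrib[symmetric])
  finally have "real d * real d \<le> 4 ^ d" .
  moreover have "(2::real) ^ d \<le> 4 ^ d" by (intro power_mono) auto
  ultimately have a: "2 * (real d * real d + 2 ^ d) \<le> 4 * (4::real) ^ d" by simp
  have "L ^ d \<le> L ^ (2 * d * d)" using L(2) by (intro power_increasing) auto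
  then have "L ^ d \<le> real N" using LN by simp
  then have "2 * (real d * real d + 2 ^ d) / real N \<le> 4 * 4 ^ d / L ^ d"
    using a L(2) by (intro frac_le) auto
  also have "\<dots> = 4 * (4 / L) ^ d" by (simp add: power_divide)
  also have "\<dots> \<le> 4 * (16 / L\<^sup>2)" using sd by simp
  also have "\<dots> \<le> 64 / L" using L(2) by (simp add: field_simps power2_eq_square)
  finally show "2 * (real d * real d + 2 ^ d) / real N \<le> 64 / L" .
qed

section \<open>Union bound and conclusion\<close>

lemma prob_diam_gt_le_sum:
  assumes "0 \<le> q" "q \<le> p" "p \<le> 1"
  shows "prob_diam_gt N p d \<le> (\<Sum>g\<in>{1..<N}.
    measure_pmf.prob (random_subset {0..<N} q) {f. \<forall>A\<in>rep_sets N g d. \<exists>x\<in>A. \<not> f x})"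
proof -
  \<comment> \<open>A decreasing event containing the event of large diameter. Passing to it first
    allows \<open>p\<close> to be lowered to \<open>q\<close> before the union bound.\<close>
  let ?Y = "\<lambda>f. \<exists>g\<in>{1..<N}. \<forall>A\<in>rep_sets N g d. \<exists>x\<in>A. \<not> f x"
  have "?Y f" if "cayley_diam N {x. x < N \<and> f x} > enat d" for f
  proof (rule ccontr)
    assume neg: "\<not> ?Y f"
    have "\<exists>A\<in>rep_sets N g d. A \<subseteq> {x. x < N \<and> f x}" if "0 < g" "g < N" for g
    proof -
      have "g \<in> {1..<N}" using that by simp
      then obtain A where A: "A \<in> rep_sets N g d" "\<forall>x\<in>A. f x" using neg by blast
      moreover have "A \<subseteq> {..<N}" using subsetD[OF rep_sets_subset A(1)] by simp
      ultimately show ?thesis by (intro bexI[of _ A]) auto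
    qed
    then show False using cayley_diam_le[of N d "{x. x < N \<and> f x}"] that by simp
  qed
  then have "prob_diam_gt N p d \<le> measure_pmf.prob (random_subset {0..<N} p) {f. ?Y f}"
    unfolding prob_diam_gt_def by (intro measure_pmf.finite_measure_mono) auto
  also have "\<dots> \<le> measure_pmf.prob (random_subset {0..<N} q) {f. ?Y f}"
  proof (rule prob_decreasing_antimono)
    show "?Y f" if "f \<le> h" "?Y h" for f h
    proof -
      obtain g where "g \<in> {1..<N}" and g: "\<forall>A\<in>rep_sets N g d. \<exists>x\<in>A. \<not> h x" using \<open>?Y h\<close> by blast
      moreover have "\<forall>A\<in>rep_sets N g d. \<exists>x\<in>A. \<not> f x"
        using g \<open>f \<le> h\<close> unfolding le_fun_def le_bool_def by blast
      ultimately show ?thesis by blast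
    qed
  qed (use assms in auto)
  also have "{f. ?Y f} = (\<Union>g\<in>{1..<N}. {f. \<forall>A\<in>rep_sets N g d. \<exists>x\<in>A. \<not> f x})" by auto
  also have "measure_pmf.prob (random_subset {0..<N} q) \<dots> \<le> (\<Sum>g\<in>{1..<N}.
    measure_pmf.prob (random_subset {0..<N} q) {f. \<forall>A\<in>rep_sets N g d. \<exists>x\<in>A. \<not> f x})"
    by (rule measure_pmf.finite_measure_subadditive_finite) auto
  finally show ?thesis .
qed

lemma prob_diam_gt_le:
  fixes \<epsilon> \<gamma> p :: real and N d :: nat
  assumes \<epsilon>: "\<epsilon> > 0" and \<gamma>: "0 < \<gamma>" "\<gamma> < 1"
    and L: "L = ln (real N)" "4 \<le> L" "128 * (1 + \<epsilon>)\<^sup>2 / \<epsilon> \<le> L" "256 * (1 + \<epsilon>) / \<epsilon> \<le> L"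
    and d: "2 \<le> d" "real d \<le> (1 - \<gamma>) * sqrt (L / (2 * ln L))"
    and p: "p \<le> 1" "root d (fact d * (1 + \<epsilon>) / 2 ^ d * (L / real N ^ (d - 1))) \<le> p"
  shows "prob_diam_gt N p d \<le> exp (- (\<epsilon> / 2 * L)) + exp (- (L / 2))"
proof -
  have N: "0 < N" using L(1,2) by (cases N) auto
  then have expL: "exp L = real N" using L(1) by simp
  define Q where "Q = fact d * (1 + \<epsilon>) / 2 ^ d * (L / real N ^ (d - 1))"
  define q where "q = root d Q"
  \<comment> \<open>Chosen so that
    \<open>(1 - 2 * \<theta>) * (1 + \<epsilon>) = 1 + \<epsilon> / 2\<close>; the two lower bounds
    on \<open>L\<close> involving \<open>\<epsilon>\<close> say exactly that \<open>\<theta>\<close>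
    dominates both error terms.\<close>
  define \<theta> where "\<theta> = \<epsilon> / (4 * (1 + \<epsilon>))"
  have Q: "0 \<le> Q" unfolding Q_def using \<epsilon> L(2) by auto
  have q: "0 \<le> q" "q \<le> p" "q ^ d = Q"
    unfolding q_def using Q p d by (auto simp: Q_def)
  have lnL: "1 \<le> ln L" using L(2) exp_le by (subst ln_ge_iff) auto
  have "real d \<le> 1 * sqrt (L / (2 * ln L))"
    using d(2) \<gamma> lnL L(2) by (elim order_trans, intro mult_right_mono) auto
  then have "(real d)\<^sup>2 \<le> (sqrt (L / (2 * ln L)))\<^sup>2" by (intro power_mono) auto
  then have dL: "real d * real d \<le> L / (2 * ln L)"
    using lnL L(2) by (simp add: power2_eq_square)
  have pw: "real N ^ d = real N * real N ^ (d - 1)" using d by (cases d) auto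
  have lam: "0 \<le> real N * q" "(real N * q) ^ d = real N * (fact d * (1 + \<epsilon>) / 2 ^ d * L)"
    using q N by (auto simp: power_mult_distrib Q_def pw)
  note est = threshold_estimates[OF \<epsilon> N L(1,2) d(1) dL lam]
  have "32 * (1 + \<epsilon>) / L \<le> \<theta>" "64 / L \<le> \<theta>"
    using L \<epsilon> unfolding \<theta>_def by (simp_all add: field_simps power2_eq_square)
  then have est': "4 ^ d * real d ^ d * (real d * (real N * q) ^ (d - 1) / real N) \<le> \<theta>"
    "2 * (real d * real d + 2 ^ d) / real N \<le> \<theta>" using est by linarith+
  have \<theta>: "\<theta> \<le> 1" unfolding \<theta>_def using \<epsilon> by simp
  have \<Lambda>: "2 ^ d * real N ^ (d - 1) * q ^ d / fact d = (1 + \<epsilon>) * L"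
    unfolding q(3) Q_def using N by simp
  have "1 - 2 * \<theta> \<le> (1 - \<theta>) * (1 - \<theta>)" by (simp add: algebra_simps)
  then have "(1 - 2 * \<theta>) * (1 + \<epsilon>) \<le> (1 - \<theta>) * (1 - \<theta>) * (1 + \<epsilon>)"
    using \<epsilon> by (intro mult_right_mono) auto
  moreover have "(1 - 2 * \<theta>) * (1 + \<epsilon>) = 1 + \<epsilon> / 2" unfolding \<theta>_def using \<epsilon> by (simp add: field_simps)
  ultimately have "(1 + \<epsilon> / 2) * L \<le> (1 - \<theta>) * (1 - \<theta>) * (1 + \<epsilon>) * L"
    using L(2) by (intro mult_right_mono) auto
  then have rate: "(1 + \<epsilon> / 2) * L \<le> (1 - \<theta>) * ((1 - \<theta>) * ((1 + \<epsilon>) * L))" by (simp add: mult_ac)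
  let ?P = "\<lambda>g. measure_pmf.prob (random_subset {0..<N} q) {f. \<forall>A\<in>rep_sets N g d. \<exists>x\<in>A. \<not> f x}"
  have Pg: "?P g \<le> exp (- ((1 + \<epsilon> / 2) * L / (if N dvd 2 * g then 2 else 1)))" if "g \<in> {1..<N}" for g
  proof -
    have "?P g \<le> exp (- ((1 - \<theta>) * ((1 - \<theta>) * ((1 + \<epsilon>) * L)) / (if N dvd 2 * g then 2 else 1)))"
      using prob_no_rep_set_le[OF _ _ d(1) q(1) _ est(1) est' \<theta>, of g] that q(2) p(1)
      unfolding \<Lambda> by simp
    also have "\<dots> \<le> exp (- ((1 + \<epsilon> / 2) * L / (if N dvd 2 * g then 2 else 1)))"
      using rate by (auto intro!: divide_right_mono)
    finally show ?thesis .
  qed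
  \<comment> \<open>Only the element of order two can satisfy this, and it exists only for even
    \<open>N\<close>.\<close>
  have half: "{g \<in> {1..<N}. N dvd 2 * g} \<subseteq> {N div 2}"
  proof
    fix g assume "g \<in> {g \<in> {1..<N}. N dvd 2 * g}"
    then obtain c where c: "2 * g = N * c" "1 \<le> g" "g < N" by auto
    then have "N * c < N * 2" by linarith
    moreover have "c \<noteq> 0" using c by (intro notI) simp
    ultimately have "c = 1" by simp
    then show "g \<in> {N div 2}" using c by auto
  qed
  have "prob_diam_gt N p d \<le> (\<Sum>g\<in>{1..<N}. ?P g)"
    by (rule prob_diam_gt_le_sum) (use q p in auto)
  \<comment> \<open>Halving the exponent still leaves at least \<open>L / 2\<close>; this weaker
    bound is charged only to the exceptional \<open>g\<close>.\<close>
  also have "\<dots> \<le> (\<Sum>g\<in>{1..<N}. exp (- ((1 + \<epsilon> / 2) * L)) + (if N dvd 2 * g then exp (- (L / 2)) else 0))"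
  proof (rule sum_mono)
    fix g assume g: "g \<in> {1..<N}"
    show "?P g \<le> exp (- ((1 + \<epsilon> / 2) * L)) + (if N dvd 2 * g then exp (- (L / 2)) else 0)"
    proof (cases "N dvd 2 * g")
      case True
      then have "?P g \<le> exp (- ((1 + \<epsilon> / 2) * L / 2))" using Pg[OF g] by simp
      also have "\<dots> \<le> exp (- (L / 2))" using \<epsilon> L(2) by simp
      finally show ?thesis using True by (simp add: add_increasing)
    next
      case False
      then show ?thesis using Pg[OF g] by simp
    qed
  qed
  also have "\<dots> = real (N - 1) * exp (- ((1 + \<epsilon> / 2) * L)) + card {g \<in> {1..<N}. N dvd 2 * g} * exp (- (L / 2))"
    by (simp add: sum.distrib sum.inter_filter[symmetric])
  also have "\<dots> \<le> real N * exp (- ((1 + \<epsilon> / 2) * L)) + 1 * exp (- (L / 2))"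
  proof (intro add_mono mult_right_mono)
    show "real (card {g \<in> {1..<N}. N dvd 2 * g}) \<le> 1" using card_mono[OF _ half] by simp
  qed auto
  also have "real N * exp (- ((1 + \<epsilon> / 2) * L)) = exp (- (\<epsilon> / 2 * L))"
    unfolding expL[symmetric] exp_add[symmetric] by (simp add: algebra_simps)
  finally show ?thesis by simp
qed

lemma exp_minus_less_inverse: "0 < x \<Longrightarrow> exp (- x) < 1 / (x::real)"
  using exp_gt_self[of x] by (simp add: exp_minus field_simps)

theorem theorem5:
  fixes \<epsilon> \<gamma> :: real
  assumes "\<epsilon> > 0" and "0 < \<gamma>" and "\<gamma> < 1"
  shows "\<forall>\<delta>>0. \<exists>N0. \<forall>N\<ge>N0. \<forall>(d::nat) (p::real).
           2 \<le> d \<and> real d \<le> (1 - \<gamma>) * sqrt (ln (real N) / (2 * ln (ln (real N)))) \<and>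
           p \<le> 1 \<and>
           p \<ge> root d (fact d * (1 + \<epsilon>) / 2 ^ d * (ln (real N) / real N ^ (d - 1)))
           \<longrightarrow> prob_diam_gt N p d < \<delta>"
proof (intro allI impI)
  fix \<delta> :: real assume \<delta>: "0 < \<delta>"
  \<comment> \<open>The last two entries make each of the two exponential terms at most
    \<open>\<delta> / 2\<close>, by way of \<open>exp (- x) < 1 / x\<close>.\<close>
  define C where "C = Max {4, 128 * (1 + \<epsilon>)\<^sup>2 / \<epsilon>, 256 * (1 + \<epsilon>) / \<epsilon>, 4 / (\<epsilon> * \<delta>), 4 / \<delta>}"
  have C: "4 \<le> C" "128 * (1 + \<epsilon>)\<^sup>2 / \<epsilon> \<le> C" "256 * (1 + \<epsilon>) / \<epsilon> \<le> C" "4 / (\<epsilon> * \<delta>) \<le> C" "4 / \<delta> \<le> C"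
    unfolding C_def by (auto intro!: Max_ge)
  show "\<exists>N0. \<forall>N\<ge>N0. \<forall>(d::nat) (p::real).
           2 \<le> d \<and> real d \<le> (1 - \<gamma>) * sqrt (ln (real N) / (2 * ln (ln (real N)))) \<and>
           p \<le> 1 \<and>
           p \<ge> root d (fact d * (1 + \<epsilon>) / 2 ^ d * (ln (real N) / real N ^ (d - 1)))
           \<longrightarrow> prob_diam_gt N p d < \<delta>"
  proof (intro exI[of _ "nat \<lceil>exp C\<rceil>"] allI impI, elim conjE)
    fix N d :: nat and p :: real
    assume N: "nat \<lceil>exp C\<rceil> \<le> N" and d: "2 \<le> d" "real d \<le> (1 - \<gamma>) * sqrt (ln (real N) / (2 * ln (ln (real N))))"
      and p: "p \<le> 1" "root d (fact d * (1 + \<epsilon>) / 2 ^ d * (ln (real N) / real N ^ (d - 1))) \<le> p"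
    define L where "L = ln (real N)"
    have "exp C \<le> real N" using N by linarith
    moreover have "0 < real N" using less_le_trans[OF exp_gt_zero calculation] .
    ultimately have CL: "C \<le> L" unfolding L_def by (simp add: ln_ge_iff)
    have L: "0 < L" using C CL by simp
    have "prob_diam_gt N p d \<le> exp (- (\<epsilon> / 2 * L)) + exp (- (L / 2))"
      using prob_diam_gt_le[OF assms L_def _ _ _ d(1) _ p(1)] C CL d(2) p(2) unfolding L_def by simp
    also have "\<dots> < 1 / (\<epsilon> / 2 * L) + 1 / (L / 2)"
      using assms(1) L by (intro add_strict_mono exp_minus_less_inverse) auto
    also have "1 / (\<epsilon> / 2 * L) \<le> \<delta> / 2"
      using order_trans[OF C(4) CL] assms(1) \<delta> L by (simp add: field_simps)
    also have "1 / (L / 2) \<le> \<delta> / 2"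
      using order_trans[OF C(5) CL] \<delta> L by (simp add: field_simps)
    finally show "prob_diam_gt N p d < \<delta>" by simp
  qed
qed

end
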